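(* Let $(\sigma,u)$ be the solution of the continuous mixed parabolic problem, $(\sigma_h,u_h)$ the semidiscrete solution, $(\tilde\sigma_h,\tilde u_h,\tilde p_h)$ the elliptic projection, and $\rho=\tilde u_h-i_h^*u$, $\theta=u_h-\tilde u_h$, $\psi=\tilde\sigma_h-i_h^*\sigma$, $\varepsilon=\sigma_h-\tilde\sigma_h$, all as defined in the context. Then there is a constant $C$ independent of $h$ such that for all $t\in I$ $$\|\theta(t)\|_h\le\|\rho_t\|_{L^1(I,W_h)}+\|\tilde p_h\|_{L^1(I,W_h)}+\|(\Pi_h-i_h^* )u_t\|_{L^1(I,W_h)},$$ $$\|d\theta(t)\|_h+\|\varepsilon(t)\|_h\le C\left(\|\rho_t\|_{L^2(I,W_h)}+\|\tilde p_h\|_{L^2(I,W_h)}+\|(\Pi_h-i_h^* )u_t\|_{L^2(I,W_h)}\right),$$ $$\|d\varepsilon(t)\|_h\le C\left(\|\psi_t\|_{L^2(I,W_h)}+\|d_h^*(\Pi_h-i_h^* )u_t\|_{L^2(I,W_h)}\right),$$ with $$\|\rho_t\|_{L^2(I,W_h)}\le C\left(\|i_h\tilde u_{h,t}-u_t\|_{L^2(I,W)}+\|I-J_h\|_{\mathcal L(W_h)}\|u_t\|_{L^2(I,W)}\right),$$ $$\|\psi_t\|_{L^2(I,W_h)}\le C\left(\|i_h\tilde\sigma_{h,t}-\sigma_t\|_{L^2(I,W)}+\|I-J_h\|_{\mathcal L(W_h)}\|\sigma_t\|_{L^2(I,W)}\right).$$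
   Context: Hilbert complexes: $(W,d)$ is a closed Hilbert complex (Hilbert spaces $W^k$, closed densely defined maps $d^k:V^k\subseteq W^k\to V^{k+1}\subseteq W^{k+1}$, $d\circ d=0$, $\mathfrak B^k=d^{k-1}V^{k-1}$ closed) with domain complex $(V,d)$ carrying the graph inner product $\langle v,w\rangle_V=\langle v,w\rangle+\langle dv,dw\rangle$; unsubscripted inner products/norms are those of $W$. $\mathfrak Z^k=\ker d^k$, $\mathfrak H^k$ is the orthogonal complement of $\mathfrak B^k$ in $\mathfrak Z^k$, $P_{\mathfrak H}$ the orthogonal projection onto $\mathfrak H^k$. $d^*$ is the adjoint of $d$, with domain $V^*_k\subseteq W^k$. $\Delta=-(dd^*+d^*d)$, with domain $\{v\in V^k\cap V_k^*: dv\in V_{k+1}^*,\ d^*v\in V^{k-1}\}$. Approximation: $(W_h,d)$ are finite-dimensional Hilbert complexes with inner product $\langle\cdot,\cdot\rangle_h$, norm $\|\cdot\|_h$, domain complex $(V_h,d)$, differentials also written $d$; $\mathfrak H_h^k$ is the orthogonal complement of $dV_h^{k-1}$ in $\ker(d|_{V_h^k})$ for $\langle\cdot,\cdot\rangle_h$; $d_h^*$ is the adjoint of $d$ with respect to $\langle\cdot,\cdot\rangle_h$. $i_h:V_h\hookrightarrow V$ are injective $W$-bounded maps commuting with $d$, $\pi_h:V\to V_h$ are $V$-bounded maps commuting with $d$ with $\pi_h\circ i_h=\mathrm{id}$, and $\Pi_h:W\to W_h$ are linear bounded interpolation operators with $\Pi_h\circ i_h=\mathrm{id}$; all norms are bounded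 uniformly in $h$. $i_h^*:W\to W_h$ is the Hilbert adjoint of $i_h$, $J_h=i_h^*i_h$. Bochner spaces: $I=[0,T]$, $\|v\|_{L^p(I,X)}=(\int_I\|v(t)\|_X^p\,dt)^{1/p}$. Subscript $t$ denotes the time derivative. $\mathfrak Y=V^{k-1}\times V^k$, $H=W^{k-1}\times W^k$, $\mathfrak Y'$ the dual of $\mathfrak Y$. Continuous problem: given source $f$ and $g\in V_k^*$, $(\sigma,u)\in L^2(I,\mathfrak Y)\cap H^1(I,\mathfrak Y')\cap C(I,H)$ satisfies, for $t\in I$, $\langle\sigma,\omega\rangle-\langle u,d\omega\rangle=0$ for all $\omega\in V^{k-1}$; $\langle u_t,\varphi\rangle+\langle du,d\varphi\rangle+\langle d\sigma,\varphi\rangle=\langle f,\varphi\rangle$ for all $\varphi\in V^k$; $u(0)=g$. Semidiscrete problem: $(\sigma_h,u_h):I\to V_h^{k-1}\times V_h^k$ with, for $t\in I$, $\langle\sigma_h,\omega_h\rangle_h-\langle u_h,d\omega_h\rangle_h=0$ for all $\omega_h\in V_h^{k-1}$; $\langle u_{h,t},\varphi_h\rangle_h+\langle d\sigma_h,\varphi_h\rangle_h+\langle du_h,d\varphi_h\rangle_h=\langle\Pi_hf,\varphi_h\rangle_h$ for all $\varphi_h\in V_h^k$; $u_h(0)=g_h:=\tilde u_h(0)$. Elliptic projection: for each $t\in I$, $(\tilde\sigma_h,\tilde u_h,\tilde p_h)(t)\in V_h^{k-1}\times V_h^k\times\mathfrak H_h^k$ is the unique solution of $\langle\tilde\sigma_h,\omega_h\rangle_h-\langle\tilde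 u_h,d\omega_h\rangle_h=0$ for all $\omega_h\in V_h^{k-1}$; $\langle d\tilde\sigma_h,\varphi_h\rangle_h+\langle d\tilde u_h,d\varphi_h\rangle_h+\langle\tilde p_h,\varphi_h\rangle_h=\langle\Pi_h(-\Delta u(t)),\varphi_h\rangle_h$ for all $\varphi_h\in V_h^k$; $\langle\tilde u_h,q_h\rangle_h=\langle\Pi_h(P_{\mathfrak H}u(t)),q_h\rangle_h$ for all $q_h\in\mathfrak H_h^k$. It is assumed that $f$ and $u$ are sufficiently regular for all these expressions, and the time derivatives and norms in the claim, to make sense (in particular $f(t)\in W^k$, and $u(t)$ and $u_t(t)$ lie in the domain of $\Delta$, with $u$, $\sigma=d^*u$ and $\Delta u$ differentiable in time with values in $W$). *)

theory Defs
  imports "HOL-Analysis.Analysis"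
begin

section \<open>Hilbert complexes\<close>

text \<open>The Hilbert spaces \<open>W\<^sup>k\<close> of a complex are complete subspaces of one ambient inner product
  space. This is no restriction: an arbitrary family of Hilbert spaces embeds isometrically in its
  direct sum. Degrees are integers, so \<open>W (k - 1)\<close> always makes sense; a complex starting in
  degree 0 has trivial spaces in negative degrees. Maps are only meaningful on their stated domain;
  their values elsewhere are irrelevant.\<close>

definition linear_between :: "'a::real_vector set \<Rightarrow> 'b::real_vector set \<Rightarrow> ('a \<Rightarrow> 'b) \<Rightarrow> bool" where
  "linear_between X Y A \<longleftrightarrow> A \<in> X \<rightarrow> Y \<and>
     (\<forall>x\<in>X. \<forall>y\<in>X. A (x + y) = A x + A y) \<and> (\<forall>c. \<forall>x\<in>X. A (c *\<^sub>R x) = c *\<^sub>R A x)"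

locale hilbert_complex =
  fixes W V :: "int \<Rightarrow> 'a::real_inner set" and d :: "int \<Rightarrow> 'a \<Rightarrow> 'a"
  assumes subspace_W: "subspace (W k)"
    and complete_W: "complete (W k)"
    and subspace_V: "subspace (V k)"
    and V_subset_W: "V k \<subseteq> W k"
    and V_dense: "W k \<subseteq> closure (V k)"
    and d_linear: "linear_between (V k) (V (k + 1)) (d k)"
    and d_closed: "closed ((\<lambda>v. (v, d k v)) ` V k)"
    and d_d: "v \<in> V k \<Longrightarrow> d (k + 1) (d k v) = 0"

locale closed_hilbert_complex = hilbert_complex +
  assumes closed_range: "closed (d k ` V k)"

locale findim_hilbert_complex = hilbert_complex +
  assumes findim: "\<exists>B. finite B \<and> W k = span B"

definition cocycles :: "(int \<Rightarrow> 'a::real_inner set) \<Rightarrow> (int \<Rightarrow> 'a \<Rightarrow> 'a) \<Rightarrow> int \<Rightarrow> 'a set" where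
  "cocycles V d k = {v \<in> V k. d k v = 0}"

definition coboundaries :: "(int \<Rightarrow> 'a::real_inner set) \<Rightarrow> (int \<Rightarrow> 'a \<Rightarrow> 'a) \<Rightarrow> int \<Rightarrow> 'a set" where
  "coboundaries V d k = d (k - 1) ` V (k - 1)"

definition harmonics :: "(int \<Rightarrow> 'a::real_inner set) \<Rightarrow> (int \<Rightarrow> 'a \<Rightarrow> 'a) \<Rightarrow> int \<Rightarrow> 'a set" where
  "harmonics V d k = {z \<in> cocycles V d k. \<forall>b \<in> coboundaries V d k. orthogonal z b}"

definition graph_norm :: "(int \<Rightarrow> 'a::real_inner \<Rightarrow> 'a) \<Rightarrow> int \<Rightarrow> 'a \<Rightarrow> real" where
  "graph_norm d k v = sqrt (v \<bullet> v + d k v \<bullet> d k v)"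

definition orth_proj :: "'a::real_inner set \<Rightarrow> 'a \<Rightarrow> 'a" where
  "orth_proj S x = (THE y. y \<in> S \<and> (\<forall>z\<in>S. orthogonal (x - y) z))"

text \<open>Adjoint of an operator \<open>A : D \<subseteq> X \<rightarrow> Y\<close> with dense domain \<open>D\<close>. It is used for \<open>d\<^sup>*\<close>,
  its discrete counterpart, and the adjoint of the embedding of the discrete spaces.\<close>

definition adj_dom :: "'a::real_inner set \<Rightarrow> 'a set \<Rightarrow> 'b::real_inner set \<Rightarrow> ('a \<Rightarrow> 'b) \<Rightarrow> 'b set" where
  "adj_dom D X Y A = {y \<in> Y. \<exists>x\<in>X. \<forall>v\<in>D. A v \<bullet> y = v \<bullet> x}"

definition adj :: "'a::real_inner set \<Rightarrow> 'a set \<Rightarrow> ('a \<Rightarrow> 'b::real_inner) \<Rightarrow> 'b \<Rightarrow> 'a" where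
  "adj D X A y = (THE x. x \<in> X \<and> (\<forall>v\<in>D. A v \<bullet> y = v \<bullet> x))"

definition dstar_dom :: "(int \<Rightarrow> 'a::real_inner set) \<Rightarrow> (int \<Rightarrow> 'a set) \<Rightarrow> (int \<Rightarrow> 'a \<Rightarrow> 'a) \<Rightarrow> int \<Rightarrow> 'a set" where
  "dstar_dom W V d k = adj_dom (V (k - 1)) (W (k - 1)) (W k) (d (k - 1))"

definition dstar :: "(int \<Rightarrow> 'a::real_inner set) \<Rightarrow> (int \<Rightarrow> 'a set) \<Rightarrow> (int \<Rightarrow> 'a \<Rightarrow> 'a) \<Rightarrow> int \<Rightarrow> 'a \<Rightarrow> 'a" where
  "dstar W V d k = adj (V (k - 1)) (W (k - 1)) (d (k - 1))"

definition laplacian_dom ::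
  "(int \<Rightarrow> 'a::real_inner set) \<Rightarrow> (int \<Rightarrow> 'a set) \<Rightarrow> (int \<Rightarrow> 'a \<Rightarrow> 'a) \<Rightarrow> int \<Rightarrow> 'a set" where
  "laplacian_dom W V d k = {v \<in> V k \<inter> dstar_dom W V d k.
     d k v \<in> dstar_dom W V d (k + 1) \<and> dstar W V d k v \<in> V (k - 1)}"

definition laplacian ::
  "(int \<Rightarrow> 'a::real_inner set) \<Rightarrow> (int \<Rightarrow> 'a set) \<Rightarrow> (int \<Rightarrow> 'a \<Rightarrow> 'a) \<Rightarrow> int \<Rightarrow> 'a \<Rightarrow> 'a" where
  "laplacian W V d k v = - (d (k - 1) (dstar W V d k v) + dstar W V d (k + 1) (d k v))"


section \<open>Approximating complexes\<close>

text \<open>The index \<open>h\<close> ranges over an arbitrary type. All discrete spaces lie in one inner product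
  space, whose inner product restricts to \<open>\<langle>\<cdot>,\<cdot>\<rangle>\<^sub>h\<close> on the spaces with index \<open>h\<close>; again
  this is no restriction, and no relation to the inner product of \<open>W\<close> is imposed.\<close>

locale complex_approximation =
  closed_hilbert_complex W V d
  for W V :: "int \<Rightarrow> 'w::real_inner set" and d :: "int \<Rightarrow> 'w \<Rightarrow> 'w" +
  fixes Wh Vh :: "'h \<Rightarrow> int \<Rightarrow> 'v::real_inner set"
    and dh :: "'h \<Rightarrow> int \<Rightarrow> 'v \<Rightarrow> 'v"
    and ih :: "'h \<Rightarrow> int \<Rightarrow> 'v \<Rightarrow> 'w"
    and pih :: "'h \<Rightarrow> int \<Rightarrow> 'w \<Rightarrow> 'v"
    and interp :: "'h \<Rightarrow> int \<Rightarrow> 'w \<Rightarrow> 'v"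
  assumes discrete_complex: "findim_hilbert_complex (Wh h) (Vh h) (dh h)"
    and ih_linear: "linear_between (Vh h k) (V k) (ih h k)"
    and ih_inj: "inj_on (ih h k) (Vh h k)"
    and ih_d: "v \<in> Vh h k \<Longrightarrow> ih h (k + 1) (dh h k v) = d k (ih h k v)"
    and ih_bounded: "\<exists>M. \<forall>h. \<forall>v\<in>Vh h k. norm (ih h k v) \<le> M * norm v"
    and pih_linear: "linear_between (V k) (Vh h k) (pih h k)"
    and pih_d: "w \<in> V k \<Longrightarrow> pih h (k + 1) (d k w) = dh h k (pih h k w)"
    and pih_bounded: "\<exists>M. \<forall>h. \<forall>w\<in>V k. graph_norm (dh h) k (pih h k w) \<le> M * graph_norm d k w"
    and pih_ih: "v \<in> Vh h k \<Longrightarrow> pih h k (ih h k v) = v"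
    and interp_linear: "linear_between (W k) (Wh h k) (interp h k)"
    and interp_bounded: "\<exists>M. \<forall>h. \<forall>w\<in>W k. norm (interp h k w) \<le> M * norm w"
    and interp_ih: "v \<in> Vh h k \<Longrightarrow> interp h k (ih h k v) = v"

definition ih_star ::
  "('h \<Rightarrow> int \<Rightarrow> 'v::real_inner set) \<Rightarrow> ('h \<Rightarrow> int \<Rightarrow> 'v set) \<Rightarrow> ('h \<Rightarrow> int \<Rightarrow> 'v \<Rightarrow> 'w::real_inner) \<Rightarrow>
   'h \<Rightarrow> int \<Rightarrow> 'w \<Rightarrow> 'v" where
  "ih_star Wh Vh ih h k = adj (Vh h k) (Wh h k) (ih h k)"

definition onorm_on :: "'a::real_normed_vector set \<Rightarrow> ('a \<Rightarrow> 'b::real_normed_vector) \<Rightarrow> real" where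
  "onorm_on S A = (SUP x\<in>S. norm (A x) / norm x)"


section \<open>Bochner norms and time derivatives\<close>

text \<open>The norm of \<open>v\<close> in \<open>L\<^sup>p([0,T],X)\<close>, where \<open>N\<close> is the norm of \<open>X\<close>. It is \<open>\<infinity>\<close> when the
  integral diverges, so that no inequality between such norms holds by a junk value.\<close>

definition bochner_norm :: "real \<Rightarrow> real \<Rightarrow> ('a \<Rightarrow> real) \<Rightarrow> (real \<Rightarrow> 'a) \<Rightarrow> ennreal" where
  "bochner_norm p T N v =
     (let J = (\<integral>\<^sup>+t\<in>{0..T}. ennreal (N (v t) powr p) \<partial>lborel)
      in if J = \<infinity> then \<infinity> else ennreal (enn2real J powr (1 / p)))"

abbreviation L1_norm :: "real \<Rightarrow> (real \<Rightarrow> 'a::real_normed_vector) \<Rightarrow> ennreal" where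
  "L1_norm T v \<equiv> bochner_norm 1 T norm v"

abbreviation L2_norm :: "real \<Rightarrow> (real \<Rightarrow> 'a::real_normed_vector) \<Rightarrow> ennreal" where
  "L2_norm T v \<equiv> bochner_norm 2 T norm v"

text \<open>One-sided derivatives at the end points of \<open>[0,T]\<close>.\<close>

definition tderiv :: "real \<Rightarrow> (real \<Rightarrow> 'a::real_normed_vector) \<Rightarrow> real \<Rightarrow> 'a" where
  "tderiv T v t = vector_derivative v (at t within {0..T})"

definition tdifferentiable :: "real \<Rightarrow> (real \<Rightarrow> 'a::real_normed_vector) \<Rightarrow> bool" where
  "tdifferentiable T v \<longleftrightarrow> (\<forall>t\<in>{0..T}. v differentiable (at t within {0..T}))"


section \<open>The continuous problem\<close>

definition Y_norm :: "(int \<Rightarrow> 'a::real_inner \<Rightarrow> 'a) \<Rightarrow> int \<Rightarrow> 'a \<times> 'a \<Rightarrow> real" where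
  "Y_norm d k y = sqrt ((graph_norm d (k - 1) (fst y))\<^sup>2 + (graph_norm d k (snd y))\<^sup>2)"

text \<open>The norm in the dual of \<open>Y = V\<^sup>k\<^sup>-\<^sup>1 \<times> V\<^sup>k\<close> of the functional \<open>y \<mapsto> \<langle>z, y\<rangle>\<close> for
  \<open>z \<in> W\<^sup>k\<^sup>-\<^sup>1 \<times> W\<^sup>k\<close>, i.e. of \<open>z\<close> under the embedding of \<open>H\<close> in the dual of \<open>Y\<close>.\<close>

definition Y_dual_norm ::
  "(int \<Rightarrow> 'a::real_inner set) \<Rightarrow> (int \<Rightarrow> 'a \<Rightarrow> 'a) \<Rightarrow> int \<Rightarrow> 'a \<times> 'a \<Rightarrow> real" where
  "Y_dual_norm V d k z = (SUP y \<in> {y \<in> V (k - 1) \<times> V k. Y_norm d k y \<le> 1}. \<bar>z \<bullet> y\<bar>)"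

text \<open>The three Bochner space conditions express
  \<open>(\<sigma>,u) \<in> L\<^sup>2(I,Y) \<inter> H\<^sup>1(I,Y') \<inter> C(I,H)\<close> for \<open>(\<sigma>,u)\<close> that is
  differentiable in \<open>H\<close>; measurability is then automatic and the weak time derivative is the
  classical one, so that \<open>u\<^sub>t\<close> takes values in \<open>W\<^sup>k\<close> and its pairing with \<open>\<phi>\<close> is an
  inner product.\<close>

definition parabolic_solution ::
  "(int \<Rightarrow> 'a::real_inner set) \<Rightarrow> (int \<Rightarrow> 'a set) \<Rightarrow> (int \<Rightarrow> 'a \<Rightarrow> 'a) \<Rightarrow> int \<Rightarrow> real \<Rightarrow>
   (real \<Rightarrow> 'a) \<Rightarrow> 'a \<Rightarrow> (real \<Rightarrow> 'a) \<Rightarrow> (real \<Rightarrow> 'a) \<Rightarrow> bool" where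
  "parabolic_solution W V d k T f g \<sigma> u \<longleftrightarrow>
     g \<in> dstar_dom W V d k \<and>
     (\<forall>t\<in>{0..T}. \<sigma> t \<in> V (k - 1) \<and> u t \<in> V k) \<and>
     bochner_norm 2 T (Y_norm d k) (\<lambda>t. (\<sigma> t, u t)) < \<infinity> \<and>
     bochner_norm 2 T (Y_dual_norm V d k) (\<lambda>t. (tderiv T \<sigma> t, tderiv T u t)) < \<infinity> \<and>
     continuous_on {0..T} (\<lambda>t. (\<sigma> t, u t)) \<and>
     (\<forall>t\<in>{0..T}.
        (\<forall>\<omega> \<in> V (k - 1). \<sigma> t \<bullet> \<omega> - u t \<bullet> d (k - 1) \<omega> = 0) \<and>
        (\<forall>\<phi> \<in> V k. tderiv T u t \<bullet> \<phi> + d k (u t) \<bullet> d k \<phi> + d (k - 1) (\<sigma> t) \<bullet> \<phi> = f t \<bullet> \<phi>)) \<and>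
     u 0 = g"

definition sufficiently_regular ::
  "(int \<Rightarrow> 'a::real_inner set) \<Rightarrow> (int \<Rightarrow> 'a set) \<Rightarrow> (int \<Rightarrow> 'a \<Rightarrow> 'a) \<Rightarrow> int \<Rightarrow> real \<Rightarrow>
   (real \<Rightarrow> 'a) \<Rightarrow> (real \<Rightarrow> 'a) \<Rightarrow> (real \<Rightarrow> 'a) \<Rightarrow> bool" where
  "sufficiently_regular W V d k T f \<sigma> u \<longleftrightarrow>
     (\<forall>t\<in>{0..T}. f t \<in> W k \<and> u t \<in> laplacian_dom W V d k \<and> tderiv T u t \<in> laplacian_dom W V d k) \<and>
     tdifferentiable T u \<and> tdifferentiable T \<sigma> \<and> tdifferentiable T (\<lambda>t. laplacian W V d k (u t))"


section \<open>The discrete problems\<close>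

definition elliptic_projection ::
  "(int \<Rightarrow> 'w::real_inner set) \<Rightarrow> (int \<Rightarrow> 'w set) \<Rightarrow> (int \<Rightarrow> 'w \<Rightarrow> 'w) \<Rightarrow>
   (int \<Rightarrow> 'v::real_inner set) \<Rightarrow> (int \<Rightarrow> 'v \<Rightarrow> 'v) \<Rightarrow> (int \<Rightarrow> 'w \<Rightarrow> 'v) \<Rightarrow> int \<Rightarrow> real \<Rightarrow> (real \<Rightarrow> 'w) \<Rightarrow>
   (real \<Rightarrow> 'v) \<Rightarrow> (real \<Rightarrow> 'v) \<Rightarrow> (real \<Rightarrow> 'v) \<Rightarrow> bool" where
  "elliptic_projection W V d V\<^sub>h d\<^sub>h \<I>\<^sub>h k T u \<sigma>' u' p' \<longleftrightarrow>
     (\<forall>t\<in>{0..T}. \<sigma>' t \<in> V\<^sub>h (k - 1) \<and> u' t \<in> V\<^sub>h k \<and> p' t \<in> harmonics V\<^sub>h d\<^sub>h k \<and>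
        (\<forall>\<omega> \<in> V\<^sub>h (k - 1). \<sigma>' t \<bullet> \<omega> - u' t \<bullet> d\<^sub>h (k - 1) \<omega> = 0) \<and>
        (\<forall>\<phi> \<in> V\<^sub>h k. d\<^sub>h (k - 1) (\<sigma>' t) \<bullet> \<phi> + d\<^sub>h k (u' t) \<bullet> d\<^sub>h k \<phi> + p' t \<bullet> \<phi>
             = \<I>\<^sub>h k (- laplacian W V d k (u t)) \<bullet> \<phi>) \<and>
        (\<forall>q \<in> harmonics V\<^sub>h d\<^sub>h k. u' t \<bullet> q = \<I>\<^sub>h k (orth_proj (harmonics V d k) (u t)) \<bullet> q))"

definition semidiscrete_solution ::
  "(int \<Rightarrow> 'v::real_inner set) \<Rightarrow> (int \<Rightarrow> 'v \<Rightarrow> 'v) \<Rightarrow> (int \<Rightarrow> 'w::real_inner \<Rightarrow> 'v) \<Rightarrow> int \<Rightarrow> real \<Rightarrow>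
   (real \<Rightarrow> 'w) \<Rightarrow> 'v \<Rightarrow> (real \<Rightarrow> 'v) \<Rightarrow> (real \<Rightarrow> 'v) \<Rightarrow> bool" where
  "semidiscrete_solution V\<^sub>h d\<^sub>h \<I>\<^sub>h k T f g\<^sub>h \<sigma>\<^sub>h u\<^sub>h \<longleftrightarrow>
     tdifferentiable T u\<^sub>h \<and>
     (\<forall>t\<in>{0..T}. \<sigma>\<^sub>h t \<in> V\<^sub>h (k - 1) \<and> u\<^sub>h t \<in> V\<^sub>h k \<and>
        (\<forall>\<omega> \<in> V\<^sub>h (k - 1). \<sigma>\<^sub>h t \<bullet> \<omega> - u\<^sub>h t \<bullet> d\<^sub>h (k - 1) \<omega> = 0) \<and>
        (\<forall>\<phi> \<in> V\<^sub>h k. tderiv T u\<^sub>h t \<bullet> \<phi> + d\<^sub>h (k - 1) (\<sigma>\<^sub>h t) \<bullet> \<phi> + d\<^sub>h k (u\<^sub>h t) \<bullet> d\<^sub>h k \<phi>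
             = \<I>\<^sub>h k (f t) \<bullet> \<phi>)) \<and>
     u\<^sub>h 0 = g\<^sub>h"

end

theory Submission
  imports Defs
begin

text \<open>Write \<open>F = -\<rho>\<^sub>t + p' + (\<Pi>\<^sub>h - i\<^sub>h\<^sup>*)u\<^sub>t\<close>. Subtracting the elliptic projection from the semidiscrete
  problem gives the error equation \<open>\<theta>\<^sub>t + d\<epsilon> + d\<^sub>h\<^sup>*d\<theta> = F\<close> with \<open>\<epsilon> = d\<^sub>h\<^sup>*\<theta>\<close> and \<open>\<theta>(0) = 0\<close>. Testing it with \<open>\<theta>\<close>
  and with \<open>\<theta>\<^sub>t\<close> bounds \<open>\<theta>\<close>, \<open>d\<theta>\<close> and \<open>\<epsilon>\<close>. Applying \<open>d\<^sub>h\<^sup>*\<close> to it and testing with \<open>\<epsilon>\<^sub>t\<close> bounds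
  \<open>d\<epsilon>\<close>, where \<open>d\<^sub>h\<^sup>*F = -\<psi>\<^sub>t + d\<^sub>h\<^sup>*(\<Pi>\<^sub>h - i\<^sub>h\<^sup>*)u\<^sub>t\<close> because \<open>p'\<close> is harmonic and
  \<open>d\<^sub>h\<^sup>*i\<^sub>h\<^sup>* = i\<^sub>h\<^sup>*d\<^sup>*\<close>. Since the time derivatives need not be continuous, the energy inequalities
  are integrated with the gauge integral. The bounds on \<open>\<rho>\<^sub>t\<close> and \<open>\<psi>\<^sub>t\<close> follow from
  \<open>x - i\<^sub>h\<^sup>*y = (I - J\<^sub>h)x + i\<^sub>h\<^sup>*(i\<^sub>h x - y)\<close>.\<close>

subsection \<open>Linear maps between subspaces\<close>

text \<open>The problem definitions ask differentiability in time only of \<open>uh\<close>, u,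
  \<sigma> and the Laplacian of u, not of \<epsilon> or of the elliptic projection. For the latter
  it is recovered by pairing with test functions: each discrete one is a harmonic element plus a
  value of the discrete Hodge Laplacian, and the pairings can be read off from the data. For
  \<epsilon> it follows because \<epsilon> is the image of \<theta> under the discrete adjoint,
  which is bounded on each finite-dimensional space. That bound may depend on h but enters no
  constant; C is built from numerical factors and the uniform bounds on \<open>ih\<close> and
  \<open>interp\<close>. Maps have meaning only on their domains, while the chain rule wants
  globally defined linear maps; composing with orthogonal projections bridges the gap, also inside
  an incomplete ambient space. Interpolation need not respect weak identities, so the continuous
  equation is first upgraded to the strong identity f = u_t - \<Delta>u, which can be interpolated
  term by term.\<close>

lemma linear_betweenD:
  assumes "linear_between X Y A"
  shows "x \<in> X \<Longrightarrow> A x \<in> Y"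
    and "x \<in> X \<Longrightarrow> y \<in> X \<Longrightarrow> A (x + y) = A x + A y"
    and "x \<in> X \<Longrightarrow> A (c *\<^sub>R x) = c *\<^sub>R A x"
  using assms by (auto simp: linear_between_def)

lemma linear_between_sum:
  assumes "linear_between X Y A" "subspace X" "\<And>i. i \<in> I \<Longrightarrow> f i \<in> X"
  shows "A (\<Sum>i\<in>I. c i *\<^sub>R f i) = (\<Sum>i\<in>I. c i *\<^sub>R A (f i))"
proof -
  have zero: "A 0 = 0"
    using linear_betweenD(3)[OF assms(1) subspace_0[OF assms(2)], of 0] by simp
  show ?thesis
    using assms(3)
  proof (induction I rule: infinite_finite_induct)
    case (insert i I)
    have "A (c i *\<^sub>R f i + (\<Sum>i\<in>I. c i *\<^sub>R f i)) = A (c i *\<^sub>R f i) + A (\<Sum>i\<in>I. c i *\<^sub>R f i)"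
      using insert.prems
      by (intro linear_betweenD(2)[OF assms(1)] subspace_scale[OF assms(2)] subspace_sum[OF assms(2)]) auto
    then show ?case
      using insert linear_betweenD(3)[OF assms(1)] by simp
  qed (simp_all add: zero)
qed

lemma linear_between_diff:
  assumes "linear_between X Y A" "subspace X" "x \<in> X" "y \<in> X"
  shows "A (x - y) = A x - A y"
  using linear_betweenD(2)[OF assms(1,3) subspace_scale[OF assms(2,4), of "-1"]]
    linear_betweenD(3)[OF assms(1,4), of "-1"] by simp

text \<open>\<open>A\<close> is arbitrary off \<open>S\<close>; precomposed with a bounded linear
  map into \<open>S\<close> it becomes a bounded linear map on the whole space, to which the chain
  rule applies. \<open>M\<close> may be negative, hence \<open>\<bar>M\<bar>\<close>.\<close>

lemma linear_between_compose_bounded_linear: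
  assumes A: "linear_between S Y A" and M: "\<And>x. x \<in> S \<Longrightarrow> norm (A x) \<le> M * norm x"
    and P: "bounded_linear P" "range P \<subseteq> S"
  shows "bounded_linear (\<lambda>x. A (P x))"
proof -
  interpret P: bounded_linear P by fact
  have in_S: "P x \<in> S" for x using P(2) by auto
  obtain K where K: "\<And>x. norm (P x) \<le> norm x * K" using P.bounded by blast
  show ?thesis
  proof (rule bounded_linear_intro[where K = "K * \<bar>M\<bar>"])
    fix x
    have "norm (A (P x)) \<le> \<bar>M\<bar> * norm (P x)"
      using M[OF in_S, of x] mult_right_mono[OF abs_ge_self[of M], of "norm (P x)"] by auto
    also have "\<dots> \<le> \<bar>M\<bar> * (norm x * K)"
      using K by (rule mult_left_mono) simp
    finally show "norm (A (P x)) \<le> norm x * (K * \<bar>M\<bar>)" by (simp add: mult_ac)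
  qed (use in_S linear_betweenD[OF A] in \<open>auto simp: P.add P.scaleR\<close>)
qed

subsection \<open>Orthogonal projections\<close>

text \<open>Treats complete subspaces and spans of finite sets alike, although the ambient space
  need not be complete.\<close>

definition projectable :: "'a::real_inner set \<Rightarrow> bool" where
  "projectable S \<longleftrightarrow> subspace S \<and> (\<forall>x. \<exists>y\<in>S. \<forall>z\<in>S. orthogonal (x - y) z)"

lemma orth_proj_eqI:
  assumes "subspace S" "y \<in> S" "\<And>z. z \<in> S \<Longrightarrow> orthogonal (x - y) z"
  shows "orth_proj S x = y"
  unfolding orth_proj_def
proof (rule the_equality)
  fix y' assume y': "y' \<in> S \<and> (\<forall>z\<in>S. orthogonal (x - y') z)"
  have "y - y' \<in> S" using assms y' by (simp add: subspace_diff)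
  then have "(x - y') \<bullet> (y - y') = 0" "(x - y) \<bullet> (y - y') = 0"
    using y' assms(3) by (auto simp: orthogonal_def)
  then have "(y - y') \<bullet> (y - y') = 0"
    by (simp add: inner_diff_left)
  then show "y' = y" by simp
qed (use assms in auto)

lemma orth_proj:
  assumes "projectable S"
  shows orth_proj_in: "orth_proj S x \<in> S"
    and orth_proj_orthogonal: "z \<in> S \<Longrightarrow> (x - orth_proj S x) \<bullet> z = 0"
proof -
  obtain y where "y \<in> S" "\<forall>z\<in>S. orthogonal (x - y) z"
    using assms unfolding projectable_def by blast
  with orth_proj_eqI[of S y x] assms
  have "orth_proj S x \<in> S \<and> (\<forall>z\<in>S. orthogonal (x - orth_proj S x) z)"
    unfolding projectable_def by auto
  then show "orth_proj S x \<in> S" "z \<in> S \<Longrightarrow> (x - orth_proj S x) \<bullet> z = 0"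
    by (auto simp: orthogonal_def)
qed

lemma orth_proj_idem:
  assumes "subspace S" "x \<in> S"
  shows "orth_proj S x = x"
  using assms by (intro orth_proj_eqI) (auto simp: orthogonal_def)

lemma bounded_linear_orth_proj:
  assumes "projectable S"
  shows "bounded_linear (orth_proj S)"
proof -
  have S: "subspace S" using assms by (simp add: projectable_def)
  note in_S = orth_proj_in[OF assms] and orth = orth_proj_orthogonal[OF assms]
  show ?thesis
  proof (rule bounded_linear_intro[where K = 1])
    fix x y
    show "orth_proj S (x + y) = orth_proj S x + orth_proj S y"
    proof (rule orth_proj_eqI[OF S])
      fix z assume "z \<in> S"
      then show "orthogonal (x + y - (orth_proj S x + orth_proj S y)) z"
        using orth[of z x] orth[of z y] by (simp add: orthogonal_def inner_diff_left inner_add_left)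
    qed (intro subspace_add[OF S] in_S)
  next
    fix r x
    show "orth_proj S (r *\<^sub>R x) = r *\<^sub>R orth_proj S x"
    proof (rule orth_proj_eqI[OF S])
      fix z assume "z \<in> S"
      then show "orthogonal (r *\<^sub>R x - r *\<^sub>R orth_proj S x) z"
        using orth[of z x] by (simp add: orthogonal_def inner_diff_left)
    qed (intro subspace_scale[OF S] in_S)
  next
    fix x
    have "orth_proj S x \<bullet> orth_proj S x = x \<bullet> orth_proj S x"
      using orth[OF in_S, of x x] by (simp add: inner_diff_left)
    also have "\<dots> \<le> norm x * norm (orth_proj S x)" by (rule norm_cauchy_schwarz)
    finally have "norm (orth_proj S x) * norm (orth_proj S x) \<le> norm x * norm (orth_proj S x)"
      by (simp add: dot_square_norm power2_eq_square)
    then show "norm (orth_proj S x) \<le> norm x * 1"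
      by (cases "norm (orth_proj S x) = 0") (auto simp: mult_le_cancel_right)
  qed
qed

text \<open>\<open>S\<close> is the fixed-point set of its continuous projection. For discrete
  spaces this turns density of the domain into equality.\<close>

lemma projectable_closed:
  assumes "projectable S"
  shows "closed S"
proof -
  have "S = {x. orth_proj S x = x}"
    using orth_proj_in[OF assms] assms orth_proj_idem
    unfolding projectable_def by (metis (mono_tags, lifting) Collect_cong Collect_mem_eq)
  moreover have "closed {x. orth_proj S x = x}"
    by (intro closed_Collect_eq continuous_intros
        bounded_linear.continuous_on[OF bounded_linear_orth_proj[OF assms]])
  ultimately show ?thesis by simp
qed

text \<open>The classical projection theorem: a minimizing sequence for the distance to
  \<open>x\<close> is Cauchy, and completeness of \<open>S\<close> stands in for that of the ambient
  space.\<close>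

lemma complete_projectable:
  fixes S :: "'a::real_inner set"
  assumes S: "subspace S" and "complete S"
  shows "projectable S"
  unfolding projectable_def
proof (intro conjI allI)
  fix x :: 'a
  define \<delta> where "\<delta> = Inf ((\<lambda>y. (norm (x - y))\<^sup>2) ` S)"
  have bdd: "bdd_below ((\<lambda>y. (norm (x - y))\<^sup>2) ` S)"
    by (intro bdd_belowI[of _ 0]) auto
  have \<delta>_le: "\<delta> \<le> (norm (x - y))\<^sup>2" if "y \<in> S" for y
    unfolding \<delta>_def using that bdd by (intro cInf_lower) auto
  have "\<exists>y\<in>S. (norm (x - y))\<^sup>2 < \<delta> + 1 / Suc n" for n
  proof -
    have "\<exists>a\<in>(\<lambda>y. (norm (x - y))\<^sup>2) ` S. a < \<delta> + 1 / Suc n"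
      unfolding \<delta>_def using subspace_0[OF S] bdd
      by (subst cInf_less_iff[symmetric]) auto
    then show ?thesis by auto
  qed
  then obtain y where y: "\<And>n. y n \<in> S" "\<And>n. (norm (x - y n))\<^sup>2 < \<delta> + 1 / Suc n"
    by metis
  \<comment> \<open>Parallelogram law for \<open>x - y m\<close> and \<open>x - y n\<close>: their
    midpoint is the difference of \<open>x\<close> and a point of \<open>S\<close>, so its squared
    norm is at least \<open>\<delta>\<close>.\<close>
  have dist_y: "(norm (y m - y n))\<^sup>2 \<le> 2 / Suc m + 2 / Suc n" for m n
  proof -
    have "(1/2) *\<^sub>R (y m + y n) \<in> S"
      by (intro subspace_scale[OF S] subspace_add[OF S] y)
    then have "4 * \<delta> \<le> 4 * (norm (x - (1/2) *\<^sub>R (y m + y n)))\<^sup>2" using \<delta>_le by simp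
    also have "\<dots> = (norm (2 *\<^sub>R (x - (1/2) *\<^sub>R (y m + y n))))\<^sup>2"
      by (simp add: power_mult_distrib)
    also have "2 *\<^sub>R (x - (1/2) *\<^sub>R (y m + y n)) = (x - y m) + (x - y n)"
      by (simp add: algebra_simps scaleR_2)
    also have "(norm ((x - y m) + (x - y n)))\<^sup>2
        = 2 * (norm (x - y m))\<^sup>2 + 2 * (norm (x - y n))\<^sup>2 - (norm (y m - y n))\<^sup>2"
      by (simp add: power2_norm_eq_inner inner_add_left inner_add_right inner_diff_left
          inner_diff_right inner_commute algebra_simps)
    finally show ?thesis using y(2)[of m] y(2)[of n] by simp
  qed
  have "Cauchy y"
  proof (rule metric_CauchyI)
    fix e :: real assume "e > 0"
    then obtain N where N: "4 / e\<^sup>2 < real (Suc N)"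
      using reals_Archimedean2 less_SucI by (metis less_trans lessI of_nat_less_iff)
    have "dist (y m) (y n) < e" if "m \<ge> N" "n \<ge> N" for m n
    proof -
      have "2 / real (Suc m) \<le> 2 / real (Suc N)" "2 / real (Suc n) \<le> 2 / real (Suc N)"
        using that by (auto intro!: divide_left_mono)
      then have "(norm (y m - y n))\<^sup>2 \<le> 4 / real (Suc N)" using dist_y[of m n] by simp
      also have "\<dots> < e\<^sup>2" using N \<open>e > 0\<close> by (simp add: field_simps)
      finally show ?thesis
        using \<open>e > 0\<close> by (simp add: dist_norm power_less_imp_less_base)
    qed
    then show "\<exists>M. \<forall>m\<ge>M. \<forall>n\<ge>M. dist (y m) (y n) < e" by blast
  qed
  then obtain l where l: "l \<in> S" "y \<longlonglongrightarrow> l"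
    using \<open>complete S\<close> y(1) unfolding complete_def by blast
  have "(\<lambda>n. (norm (x - y n))\<^sup>2) \<longlonglongrightarrow> (norm (x - l))\<^sup>2"
    by (intro tendsto_intros l)
  moreover have "(\<lambda>n. \<delta> + 1 / Suc n) \<longlonglongrightarrow> \<delta> + 0"
    by (intro tendsto_intros LIMSEQ_Suc[OF lim_1_over_n])
  ultimately have min: "(norm (x - l))\<^sup>2 \<le> \<delta>"
    using y(2) by (intro LIMSEQ_le) (auto intro: less_imp_le)
  have "(x - l) \<bullet> z = 0" if "z \<in> S" for z
  proof (rule ccontr)
    assume nz: "(x - l) \<bullet> z \<noteq> 0"
    then have "z \<bullet> z > 0" by auto
    \<comment> \<open>\<open>c\<close> minimizes the distance to \<open>x\<close> along the line
      through \<open>l\<close> in direction \<open>z\<close>; the resulting decrease would undercut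
      the infimum.\<close>
    define c where "c = ((x - l) \<bullet> z) / (z \<bullet> z)"
    have "l + c *\<^sub>R z \<in> S" by (intro subspace_add[OF S] subspace_scale[OF S] l that)
    then have "(norm (x - l))\<^sup>2 \<le> (norm ((x - l) - c *\<^sub>R z))\<^sup>2"
      using order_trans[OF min \<delta>_le] by (simp only: diff_diff_eq)
    also have "\<dots> = (norm (x - l))\<^sup>2 - 2 * c * ((x - l) \<bullet> z) + c\<^sup>2 * (z \<bullet> z)"
      unfolding power2_norm_eq_inner
      by (simp add: inner_diff_left inner_diff_right inner_commute power2_eq_square algebra_simps)
    also have "\<dots> = (norm (x - l))\<^sup>2 - ((x - l) \<bullet> z)\<^sup>2 / (z \<bullet> z)"
      using \<open>z \<bullet> z > 0\<close> by (simp add: c_def power2_eq_square field_simps)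
    finally show False using nz \<open>z \<bullet> z > 0\<close>
      by (simp add: divide_le_0_iff)
  qed
  then show "\<exists>y\<in>S. \<forall>z\<in>S. orthogonal (x - y) z"
    using l(1) by (auto simp: orthogonal_def)
qed (fact S)

subsection \<open>Finite-dimensional subspaces\<close>

text \<open>The vectors are not normalized and 0 may be among them: coefficients divide by
  \<open>c \<bullet> c\<close>, and with x / 0 = 0 a zero vector contributes nothing. Gram-Schmidt
  in \<open>basis_orthogonal\<close> delivers this form.\<close>

definition orth_basis :: "'a::real_inner set \<Rightarrow> 'a set \<Rightarrow> bool" where
  "orth_basis S C \<longleftrightarrow> finite C \<and> pairwise orthogonal C \<and> S = span C"

lemma orth_basis_exists:
  assumes "finite B" "S = span B"
  shows "\<exists>C. orth_basis S C"
  using basis_orthogonal[OF assms(1)] assms(2) unfolding orth_basis_def by blast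

lemma orth_basis_projection:
  assumes C: "orth_basis S C" and z: "z \<in> S"
  shows "(x - (\<Sum>c\<in>C. (x \<bullet> c / (c \<bullet> c)) *\<^sub>R c)) \<bullet> z = 0"
proof -
  let ?y = "\<Sum>c\<in>C. (x \<bullet> c / (c \<bullet> c)) *\<^sub>R c"
  have "orthogonal (x - ?y) z"
  proof (rule orthogonal_to_span)
    show "z \<in> span C" using C z by (simp add: orth_basis_def)
    fix b assume b: "b \<in> C"
    have "?y \<bullet> b = (\<Sum>c\<in>C. if c = b then x \<bullet> b else 0)"
      unfolding inner_sum_left
      using C b by (intro sum.cong) (auto simp: orth_basis_def pairwise_def orthogonal_def)
    also have "\<dots> = x \<bullet> b" using C b by (simp add: orth_basis_def)
    finally show "orthogonal (x - ?y) b" by (simp add: orthogonal_def inner_diff_left)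
  qed
  then show ?thesis by (simp add: orthogonal_def)
qed

lemma orth_basis_subspace: "orth_basis S C \<Longrightarrow> subspace S"
  by (simp add: orth_basis_def)

lemma orth_basis_subset: "orth_basis S C \<Longrightarrow> c \<in> C \<Longrightarrow> c \<in> S"
  by (simp add: orth_basis_def span_base)

lemma orth_basis_expansion:
  assumes C: "orth_basis S C" and x: "x \<in> S"
  shows "x = (\<Sum>c\<in>C. (x \<bullet> c / (c \<bullet> c)) *\<^sub>R c)"
proof -
  let ?y = "\<Sum>c\<in>C. (x \<bullet> c / (c \<bullet> c)) *\<^sub>R c"
  have "x - ?y \<in> S"
    using x orth_basis_subspace[OF C] orth_basis_subset[OF C]
    by (intro subspace_diff subspace_sum subspace_scale) auto
  then show ?thesis using orth_basis_projection[OF C, of "x - ?y" x] by simp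
qed

lemma orth_basis_projectable:
  assumes C: "orth_basis S C"
  shows "projectable S"
  unfolding projectable_def
proof (intro conjI allI)
  fix x
  have "(\<Sum>c\<in>C. (x \<bullet> c / (c \<bullet> c)) *\<^sub>R c) \<in> S"
    using orth_basis_subspace[OF C] orth_basis_subset[OF C]
    by (intro subspace_sum subspace_scale) auto
  then show "\<exists>y\<in>S. \<forall>z\<in>S. orthogonal (x - y) z"
    using orth_basis_projection[OF C] by (auto simp: orthogonal_def)
qed (rule orth_basis_subspace[OF C])

lemma orth_basis_linear:
  assumes "orth_basis S C" "linear_between S Y A" "x \<in> S"
  shows "A x = (\<Sum>c\<in>C. (x \<bullet> c / (c \<bullet> c)) *\<^sub>R A c)"
proof -
  have "A x = A (\<Sum>c\<in>C. (x \<bullet> c / (c \<bullet> c)) *\<^sub>R c)"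
    using orth_basis_expansion[OF assms(1,3)] by (rule arg_cong)
  also have "\<dots> = (\<Sum>c\<in>C. (x \<bullet> c / (c \<bullet> c)) *\<^sub>R A c)"
    using linear_between_sum[OF assms(2) orth_basis_subspace[OF assms(1)] orth_basis_subset[OF assms(1)]] .
  finally show ?thesis .
qed

text \<open>The constant depends on the basis, hence on h for the discrete spaces; it serves only
  for continuity and differentiation, never for an estimate of the theorem.\<close>

lemma orth_basis_bounded:
  assumes "orth_basis S C" "linear_between S Y A"
  shows "\<exists>M. \<forall>x\<in>S. norm (A x) \<le> M * norm x"
proof (intro exI ballI)
  fix x assume "x \<in> S"
  have "norm (A x) \<le> (\<Sum>c\<in>C. norm ((x \<bullet> c / (c \<bullet> c)) *\<^sub>R A c))"
    unfolding orth_basis_linear[OF assms \<open>x \<in> S\<close>] by (rule norm_sum)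
  also have "\<dots> \<le> (\<Sum>c\<in>C. norm x * (norm c * norm (A c) / (c \<bullet> c)))"
  proof (rule sum_mono)
    fix c
    have "\<bar>x \<bullet> c\<bar> * (norm (A c) / (c \<bullet> c)) \<le> norm x * norm c * (norm (A c) / (c \<bullet> c))"
      by (intro mult_right_mono Cauchy_Schwarz_ineq2) simp
    then show "norm ((x \<bullet> c / (c \<bullet> c)) *\<^sub>R A c) \<le> norm x * (norm c * norm (A c) / (c \<bullet> c))"
      by (simp add: mult_ac)
  qed
  finally show "norm (A x) \<le> (\<Sum>c\<in>C. norm c * norm (A c) / (c \<bullet> c)) * norm x"
    by (simp add: sum_distrib_left mult.commute)
qed

text \<open>Two candidates differ by a vector of \<open>X\<close> that is orthogonal to
  \<open>D\<close>, hence to its closure, hence to itself.\<close>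

lemma adj_eqI:
  assumes "X \<subseteq> closure D" "subspace X" "x \<in> X" "\<And>v. v \<in> D \<Longrightarrow> A v \<bullet> y = v \<bullet> x"
  shows "adj D X A y = x"
  unfolding adj_def
proof (rule the_equality)
  fix x' assume x': "x' \<in> X \<and> (\<forall>v\<in>D. A v \<bullet> y = v \<bullet> x')"
  have "closed {v. v \<bullet> (x - x') = 0}"
    by (intro closed_Collect_eq continuous_intros)
  moreover have "D \<subseteq> {v. v \<bullet> (x - x') = 0}"
    using x' assms(4) by (auto simp: inner_diff_right)
  ultimately have "closure D \<subseteq> {v. v \<bullet> (x - x') = 0}" by (rule closure_minimal[rotated])
  moreover have "x - x' \<in> X" using assms(2,3) x' by (simp add: subspace_diff)
  ultimately have "(x - x') \<bullet> (x - x') = 0" using assms(1) by blast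
  then show "x' = x" by simp
qed (use assms in auto)

lemma
  assumes C: "orth_basis S C" and A: "linear_between S Y A"
  shows adj_findim_in: "adj S S A y \<in> S"
    and adj_findim_inner: "v \<in> S \<Longrightarrow> A v \<bullet> y = v \<bullet> adj S S A y"
proof -
  \<comment> \<open>The Riesz representative in coordinates: expanding \<open>v\<close> in the basis
    turns \<open>A v \<bullet> y\<close> into an inner product with this sum.\<close>
  let ?x = "\<Sum>c\<in>C. ((A c \<bullet> y) / (c \<bullet> c)) *\<^sub>R c"
  have S: "subspace S" by (rule orth_basis_subspace[OF C])
  have x: "?x \<in> S"
    using S orth_basis_subset[OF C] by (intro subspace_sum subspace_scale) auto
  have inner: "A v \<bullet> y = v \<bullet> ?x" if "v \<in> S" for v
    unfolding orth_basis_linear[OF C A that] by (simp add: inner_sum_left inner_sum_right mult_ac)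
  have "adj S S A y = ?x"
    using S x inner closure_subset by (intro adj_eqI) auto
  with x inner show "adj S S A y \<in> S" "v \<in> S \<Longrightarrow> A v \<bullet> y = v \<bullet> adj S S A y"
    by auto
qed

text \<open>Testing the defining identity with the adjoint value itself reproduces the bound of
  \<open>A\<close>, so the adjoint of \<open>ih\<close> inherits a bound uniform in h.\<close>

lemma adj_findim_norm_le:
  assumes C: "orth_basis S C" and A: "linear_between S Y A"
    and M: "\<And>x. x \<in> S \<Longrightarrow> norm (A x) \<le> M * norm x" and "0 \<le> M"
  shows "norm (adj S S A y) \<le> M * norm y"
proof -
  let ?x = "adj S S A y"
  note in_S = adj_findim_in[OF C A]
  have "norm ?x * norm ?x = A ?x \<bullet> y"
    using adj_findim_inner[OF C A in_S, of y y] by (simp add: dot_square_norm power2_eq_square)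
  also have "\<dots> \<le> norm (A ?x) * norm y" by (rule norm_cauchy_schwarz)
  also have "\<dots> \<le> M * norm ?x * norm y" by (intro mult_right_mono M in_S) simp
  finally have "norm ?x * norm ?x \<le> norm ?x * (M * norm y)" by (simp add: mult_ac)
  then show ?thesis
    using \<open>0 \<le> M\<close> by (cases "norm ?x = 0") (auto simp: mult_le_cancel_left)
qed

lemma bounded_linear_adj_findim:
  assumes C: "orth_basis S C" and A: "linear_between S Y A"
  shows "bounded_linear (adj S S A)"
proof -
  have S: "subspace S" by (rule orth_basis_subspace[OF C])
  note adj = adj_findim_in[OF C A] adj_findim_inner[OF C A]
  obtain M where M: "\<And>x. x \<in> S \<Longrightarrow> norm (A x) \<le> M * norm x"
    using orth_basis_bounded[OF C A] by blast
  have M': "norm (A x) \<le> \<bar>M\<bar> * norm x" if "x \<in> S" for x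
    using M[OF that] mult_right_mono[OF abs_ge_self[of M], of "norm x"] by auto
  show ?thesis
  proof (rule bounded_linear_intro[where K = "\<bar>M\<bar>"])
    show "adj S S A (x + y) = adj S S A x + adj S S A y" for x y
      using S closure_subset adj by (intro adj_eqI) (auto simp: inner_add_right subspace_add)
    show "adj S S A (r *\<^sub>R x) = r *\<^sub>R adj S S A x" for r x
      using S closure_subset adj by (intro adj_eqI) (auto simp: subspace_scale)
    show "norm (adj S S A x) \<le> norm x * \<bar>M\<bar>" for x
      using adj_findim_norm_le[OF C A M', of x] by (simp add: mult.commute)
  qed
qed

subsection \<open>Time derivatives\<close>

text \<open>\<open>0 < T\<close> makes derivatives within the interval unique: in a one-point
  interval no nearby points determine them.\<close>

lemma tderiv_eqI:
  assumes "0 < T" "t \<in> {0..T}" "(v has_vector_derivative v') (at t within {0..T})"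
  shows "tderiv T v t = v'"
  using vector_derivative_within_cbox[of 0 T t v v'] assms by (simp add: tderiv_def)

lemma tderiv_works:
  assumes "tdifferentiable T v" "t \<in> {0..T}"
  shows "(v has_vector_derivative tderiv T v t) (at t within {0..T})"
  using assms by (auto simp: tdifferentiable_def tderiv_def vector_derivative_works[symmetric])

lemma tdifferentiableI:
  assumes "\<And>t. t \<in> {0..T} \<Longrightarrow> (v has_vector_derivative v' t) (at t within {0..T})"
  shows "tdifferentiable T v"
  using assms unfolding tdifferentiable_def by (blast intro: differentiableI_vector)

lemma tdifferentiable_continuous_on: "tdifferentiable T v \<Longrightarrow> continuous_on {0..T} v"
  unfolding tdifferentiable_def continuous_on_eq_continuous_within
  by (blast intro: differentiable_imp_continuous_within)

text \<open>The projection onto \<open>S\<close> fixes the curve, so the projected derivative is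
  also its derivative; uniqueness identifies the two.\<close>

lemma projectable_has_vector_derivative_in:
  assumes "projectable S" "0 < T" "\<And>s. s \<in> {0..T} \<Longrightarrow> v s \<in> S" "t \<in> {0..T}"
    and v': "(v has_vector_derivative v') (at t within {0..T})"
  shows "v' \<in> S"
proof -
  have S: "subspace S" using assms(1) by (simp add: projectable_def)
  have "((\<lambda>s. orth_proj S (v s)) has_vector_derivative orth_proj S v') (at t within {0..T})"
    by (rule bounded_linear.has_vector_derivative[OF bounded_linear_orth_proj[OF assms(1)] v'])
  then have "(v has_vector_derivative orth_proj S v') (at t within {0..T})"
    by (rule has_vector_derivative_transform[OF assms(4), rotated])
       (use assms(3) orth_proj_idem[OF S] in simp)
  then have "orth_proj S v' = v'"
    using tderiv_eqI[OF assms(2,4)] v' by metis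
  then show ?thesis using orth_proj_in[OF assms(1), of v'] by simp
qed

text \<open>The chain rule is applied to \<open>A\<close> after the projection onto
  \<open>S\<close>, which agrees with \<open>A\<close> along the curve. This serves the discrete
  differential, \<open>ih\<close> and \<open>interp\<close>.\<close>

lemma has_vector_derivative_linear_between:
  assumes S: "projectable S" and "0 < T" and v: "\<And>s. s \<in> {0..T} \<Longrightarrow> v s \<in> S" and t: "t \<in> {0..T}"
    and v': "(v has_vector_derivative v') (at t within {0..T})"
    and A: "linear_between S Y A" and M: "\<exists>M. \<forall>x\<in>S. norm (A x) \<le> M * norm x"
  shows "((\<lambda>s. A (v s)) has_vector_derivative A v') (at t within {0..T})"
proof -
  have sub: "subspace S" using S by (simp add: projectable_def)
  obtain M where "\<And>x. x \<in> S \<Longrightarrow> norm (A x) \<le> M * norm x" using M by blast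
  moreover have "range (orth_proj S) \<subseteq> S" using orth_proj_in[OF S] by blast
  ultimately have "bounded_linear (\<lambda>x. A (orth_proj S x))"
    by (rule linear_between_compose_bounded_linear[OF A _ bounded_linear_orth_proj[OF S]])
  then have "((\<lambda>s. A (orth_proj S (v s))) has_vector_derivative A (orth_proj S v')) (at t within {0..T})"
    using v' by (rule bounded_linear.has_vector_derivative)
  moreover have "orth_proj S v' = v'"
    using projectable_has_vector_derivative_in[OF S \<open>0 < T\<close> v t v'] by (rule orth_proj_idem[OF sub])
  ultimately have "((\<lambda>s. A (orth_proj S (v s))) has_vector_derivative A v') (at t within {0..T})"
    by simp
  then show ?thesis
    by (rule has_vector_derivative_transform[OF t, rotated])
       (simp add: v orth_proj_idem[OF sub])
qed

text \<open>The fundamental theorem of calculus for the gauge integral needs no integrability of the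
  derivative; this is why no continuity of \<open>\<phi>'\<close> is required.\<close>

lemma has_vector_derivative_le_imp_nn_integral:
  fixes \<phi> :: "real \<Rightarrow> real"
  assumes \<phi>: "\<And>s. s \<in> {0..T} \<Longrightarrow> (\<phi> has_vector_derivative \<phi>' s) (at s within {0..T})"
    and le: "\<And>s. s \<in> {0..T} \<Longrightarrow> \<phi>' s \<le> g s" and nonneg: "\<And>s. s \<in> {0..T} \<Longrightarrow> 0 \<le> g s"
    and g: "set_borel_measurable borel {0..T} g" and t: "t \<in> {0..T}"
  shows "ennreal (\<phi> t - \<phi> 0) \<le> (\<integral>\<^sup>+s\<in>{0..T}. ennreal (g s) \<partial>lborel)"
proof (cases "(\<integral>\<^sup>+s\<in>{0..T}. ennreal (g s) \<partial>lborel) < \<infinity>")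
  case True
  have "(\<integral>\<^sup>+s. ennreal (indicator {0..T} s * g s) \<partial>lborel) = (\<integral>\<^sup>+s\<in>{0..T}. ennreal (g s) \<partial>lborel)"
    by (intro nn_integral_cong) (auto simp: indicator_def)
  then have "(\<lambda>s. indicator {0..T} s * g s) integrable_on UNIV"
    using g nonneg True
    by (intro nn_integral_integrable_on) (auto simp: set_borel_measurable_def indicator_def)
  moreover have "(\<lambda>s. indicator {0..T} s * g s) = (\<lambda>s. if s \<in> {0..T} then g s else 0)"
    by (auto simp: indicator_def)
  ultimately have int: "g integrable_on {0..T}"
    using integrable_restrict_UNIV[of "{0..T}" g] by simp
  then have int_t: "g integrable_on {0..t}"
    using t by (intro integrable_on_subinterval[OF int]) auto
  have "(\<phi>' has_integral (\<phi> t - \<phi> 0)) {0..t}"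
    using t by (intro fundamental_theorem_of_calculus)
      (auto intro: has_vector_derivative_within_subset[OF \<phi>])
  then have "\<phi> t - \<phi> 0 \<le> integral {0..t} g"
    using t le by (intro has_integral_le[OF _ integrable_integral[OF int_t]]) auto
  also have "\<dots> \<le> integral {0..T} g"
    using t nonneg by (intro integral_subset_le int int_t) auto
  finally show ?thesis
    using set_nn_integral_lborel_eq_integral[OF g nonneg True] by (simp add: ennreal_leI)
qed (simp add: less_top[symmetric])

section \<open>Measurability of the norms of curves and of their time derivatives\<close>

lemma set_borel_measurable_norm_continuous:
  assumes "continuous_on {0..T} v"
  shows "set_borel_measurable borel {0..T::real} (\<lambda>t. norm (v t))"
  unfolding set_borel_measurable_def
  using assms by (intro borel_measurable_continuous_on_indicator continuous_intros) auto

text \<open>A derivative need not be continuous, but it is the pointwise limit of difference quotients.\<close>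

lemma set_borel_measurable_norm_tderiv:
  fixes v :: "real \<Rightarrow> 'a::real_normed_vector"
  assumes v: "tdifferentiable T v" and "0 < T"
  shows "set_borel_measurable borel {0..T} (\<lambda>t. norm (tderiv T v t))"
proof -
  \<comment> \<open>Forward difference quotients, with \<open>min T\<close> keeping the second point
    in the interval. At \<open>t = T\<close> they vanish identically, so the limit is taken on
    \<open>{0..<T}\<close> and the end point is added separately.\<close>
  let ?q = "\<lambda>n t. real (Suc n) * norm (v (min T (t + 1 / Suc n)) - v t)"
  have cont: "continuous_on {0..T} v" using v by (rule tdifferentiable_continuous_on)
  have q_cont: "continuous_on {0..<T} (?q n)" for n
    by (intro continuous_intros continuous_on_compose2[OF cont] continuous_on_subset[OF cont]) auto
  have q_lim: "(\<lambda>n. ?q n t) \<longlonglongrightarrow> norm (tderiv T v t)" if t: "t \<in> {0..<T}" for t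
  proof -
    define s where "s = (\<lambda>n. min T (t + 1 / Suc n))"
    have "(\<lambda>n. t + 1 / Suc n) \<longlonglongrightarrow> t + 0"
      by (intro tendsto_intros LIMSEQ_Suc[OF lim_1_over_n])
    then have lim: "(\<lambda>n. t + 1 / Suc n) \<longlonglongrightarrow> t" by simp
    then have "(\<lambda>n. min T (t + 1 / Suc n)) \<longlonglongrightarrow> min T t" by (intro tendsto_intros)
    then have s_lim: "s \<longlonglongrightarrow> t" using t by (simp add: s_def)
    have "s n \<in> {0..T} \<and> s n \<noteq> t" for n
      using t by (auto simp: s_def min_def add_nonneg_nonneg)
    then have s: "filterlim s (at t within {0..T}) sequentially"
      using s_lim by (auto simp: filterlim_at)
    have "((\<lambda>y. (1 / norm (y - t)) *\<^sub>R (v y - (v t + (y - t) *\<^sub>R tderiv T v t))) \<longlongrightarrow> 0) (at t within {0..T})"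
      using tderiv_works[OF v, of t] t
      by (auto simp: has_vector_derivative_def has_derivative_within)
    from filterlim_compose[OF this s]
    have "(\<lambda>n. (1 / norm (s n - t)) *\<^sub>R (v (s n) - (v t + (s n - t) *\<^sub>R tderiv T v t))) \<longlonglongrightarrow> 0" .
    moreover have "eventually (\<lambda>n. t + 1 / Suc n < T) sequentially"
      using order_tendstoD(2)[OF lim, of T] t by simp
    then have "eventually (\<lambda>n. (1 / norm (s n - t)) *\<^sub>R (v (s n) - (v t + (s n - t) *\<^sub>R tderiv T v t))
        = real (Suc n) *\<^sub>R (v (s n) - v t) - tderiv T v t) sequentially"
    proof eventually_elim
      case (elim n)
      then have "s n - t = 1 / Suc n" by (simp add: s_def min_def)
      then show ?case by (simp add: algebra_simps)
    qed
    ultimately have "(\<lambda>n. real (Suc n) *\<^sub>R (v (s n) - v t) - tderiv T v t) \<longlonglongrightarrow> 0"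
      by (blast intro: Lim_transform_eventually)
    then have "(\<lambda>n. real (Suc n) *\<^sub>R (v (s n) - v t)) \<longlonglongrightarrow> tderiv T v t"
      by (simp add: LIM_zero_iff)
    then have "(\<lambda>n. norm (real (Suc n) *\<^sub>R (v (s n) - v t))) \<longlonglongrightarrow> norm (tderiv T v t)"
      by (rule tendsto_norm)
    then show ?thesis by (simp add: s_def)
  qed
  have "(\<lambda>t. indicator {0..<T} t *\<^sub>R norm (tderiv T v t)) \<in> borel_measurable borel"
  proof (rule borel_measurable_LIMSEQ_real)
    show "(\<lambda>t. indicator {0..<T} t *\<^sub>R ?q n t) \<in> borel_measurable borel" for n
      by (intro borel_measurable_continuous_on_indicator q_cont) auto
    show "(\<lambda>n. indicator {0..<T} t *\<^sub>R ?q n t) \<longlonglongrightarrow> indicator {0..<T} t *\<^sub>R norm (tderiv T v t)" for t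
      using q_lim[of t] by (auto simp: indicator_def)
  qed
  then have "(\<lambda>t. indicator {0..<T} t *\<^sub>R norm (tderiv T v t)
      + indicator {T} t * norm (tderiv T v T)) \<in> borel_measurable borel"
    by measurable
  also have "(\<lambda>t. indicator {0..<T} t *\<^sub>R norm (tderiv T v t) + indicator {T} t * norm (tderiv T v T))
      = (\<lambda>t. indicator {0..T} t *\<^sub>R norm (tderiv T v t))"
    using \<open>0 < T\<close> by (auto simp: indicator_def fun_eq_iff)
  finally show ?thesis by (simp add: set_borel_measurable_def)
qed

lemma set_borel_measurable_add:
  fixes f g :: "real \<Rightarrow> real"
  assumes "set_borel_measurable M A f" "set_borel_measurable M A g"
  shows "set_borel_measurable M A (\<lambda>t. f t + g t)"
  using borel_measurable_add[OF assms[unfolded set_borel_measurable_def]]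
  by (simp add: set_borel_measurable_def algebra_simps)

lemma set_borel_measurable_congI:
  fixes f g :: "'a \<Rightarrow> real"
  assumes "set_borel_measurable M A f" "\<And>t. t \<in> A \<Longrightarrow> g t = f t"
  shows "set_borel_measurable M A g"
proof -
  have "(\<lambda>x. indicator A x *\<^sub>R g x) = (\<lambda>x. indicator A x *\<^sub>R f x)"
    using assms(2) by (auto simp: indicator_def fun_eq_iff)
  then show ?thesis using assms(1) by (simp add: set_borel_measurable_def)
qed

lemma set_borel_measurable_norm_power2:
  fixes f :: "'a \<Rightarrow> real"
  assumes "set_borel_measurable M A f"
  shows "set_borel_measurable M A (\<lambda>s. (norm (f s))\<^sup>2)"
proof -
  have "(\<lambda>s. (indicator A s *\<^sub>R f s)\<^sup>2) \<in> borel_measurable M"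
    using assms unfolding set_borel_measurable_def by measurable
  also have "(\<lambda>s. (indicator A s *\<^sub>R f s)\<^sup>2) = (\<lambda>s. indicator A s *\<^sub>R (norm (f s))\<^sup>2)"
    by (auto simp: indicator_def)
  finally show ?thesis by (simp add: set_borel_measurable_def)
qed

subsection \<open>Bochner norms\<close>

text \<open>Isolates the last step of the L2 norm, with the same value at \<open>\<infinity>\<close>
  as in \<open>bochner_norm\<close>, so that inequalities can be proved for the integrals
  first.\<close>

definition ennsqrt :: "ennreal \<Rightarrow> ennreal" where
  "ennsqrt x = (if x = \<infinity> then \<infinity> else ennreal (sqrt (enn2real x)))"

lemma L1_norm_eq: "L1_norm T v = (\<integral>\<^sup>+t\<in>{0..T}. ennreal (norm (v t)) \<partial>lborel)"
  by (auto simp: bochner_norm_def Let_def less_top)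

lemma L2_norm_eq: "L2_norm T v = ennsqrt (\<integral>\<^sup>+t\<in>{0..T}. ennreal ((norm (v t))\<^sup>2) \<partial>lborel)"
  by (auto simp: bochner_norm_def Let_def ennsqrt_def powr_half_sqrt)

lemma le_ennsqrt:
  assumes "ennreal (a\<^sup>2) \<le> x" "0 \<le> a"
  shows "ennreal a \<le> ennsqrt x"
proof (cases x)
  case (real r)
  then have "a\<^sup>2 \<le> r" using assms by simp
  then have "a \<le> sqrt r" using assms(2) by (simp add: real_le_rsqrt)
  then show ?thesis using real by (auto simp: ennsqrt_def intro: ennreal_leI)
qed (simp add: ennsqrt_def)

text \<open>Subadditivity of the square root, from \<open>p\<^sup>2 * r + q\<^sup>2 * s \<le> (p *
  sqrt r + q * sqrt s)\<^sup>2\<close>. An infinite argument with weight 0 is harmless because 0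
  times \<infinity> is 0 in \<open>ennreal\<close>; it is represented by r = 0.\<close>

lemma ennsqrt_le:
  assumes le: "x \<le> ennreal (p\<^sup>2) * a + ennreal (q\<^sup>2) * b" and "0 \<le> p" "0 \<le> q"
  shows "ennsqrt x \<le> ennreal p * ennsqrt a + ennreal q * ennsqrt b"
proof (cases "(p \<noteq> 0 \<and> a = \<infinity>) \<or> (q \<noteq> 0 \<and> b = \<infinity>)")
  case True
  then have "ennreal p * ennsqrt a + ennreal q * ennsqrt b = \<infinity>"
    using assms by (auto simp: ennsqrt_def ennreal_mult_top)
  then show ?thesis by (simp only: infinity_ennreal_def top_greatest)
next
  case False
  have eq: "\<exists>r\<ge>0. ennreal (p\<^sup>2) * a = ennreal (p\<^sup>2 * r) \<and> ennreal p * ennsqrt a = ennreal (p * sqrt r)"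
    if "p = 0 \<or> a \<noteq> \<infinity>" "0 \<le> p" for p a
  proof (cases a)
    case (real r)
    then show ?thesis
      using that by (intro exI[of _ r]) (auto simp: ennsqrt_def ennreal_mult)
  qed (use that in \<open>auto intro: exI[of _ 0]\<close>)
  obtain r where r: "r \<ge> 0" "ennreal (p\<^sup>2) * a = ennreal (p\<^sup>2 * r)"
      "ennreal p * ennsqrt a = ennreal (p * sqrt r)"
    using eq[of p a] False assms by blast
  obtain s where s: "s \<ge> 0" "ennreal (q\<^sup>2) * b = ennreal (q\<^sup>2 * s)"
      "ennreal q * ennsqrt b = ennreal (q * sqrt s)"
    using eq[of q b] False assms by blast
  have le': "x \<le> ennreal (p\<^sup>2 * r + q\<^sup>2 * s)"
    using le r s by simp
  then obtain y where y: "x = ennreal y" "0 \<le> y"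
    by (cases x) (auto simp: top_unique)
  have y_le: "y \<le> p\<^sup>2 * r + q\<^sup>2 * s"
    using le' r(1) s(1) unfolding y(1) by (subst (asm) ennreal_le_iff) auto
  have "p\<^sup>2 * r + q\<^sup>2 * s \<le> (p * sqrt r + q * sqrt s)\<^sup>2"
    using r(1) s(1) assms by (simp add: power2_sum power_mult_distrib)
  then have "sqrt y \<le> p * sqrt r + q * sqrt s"
    using y y_le r(1) s(1) assms by (intro real_le_lsqrt) auto
  then have "ennreal (sqrt y) \<le> ennreal (p * sqrt r) + ennreal (q * sqrt s)"
    using r(1) s(1) assms by (simp add: ennreal_leI flip: ennreal_plus)
  then show ?thesis using y r s by (simp add: ennsqrt_def)
qed

lemma L1_norm_add_le:
  assumes le: "\<And>t. t \<in> {0..T} \<Longrightarrow> norm (c t) \<le> norm (a t) + norm (b t)"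
    and a: "set_borel_measurable borel {0..T} (\<lambda>t. norm (a t))"
    and b: "set_borel_measurable borel {0..T} (\<lambda>t. norm (b t))"
  shows "L1_norm T c \<le> L1_norm T a + L1_norm T b"
proof -
  have meas: "(\<lambda>t. ennreal (norm (f t)) * indicator {0..T} t) \<in> borel_measurable lborel"
    if "set_borel_measurable borel {0..T} (\<lambda>t. norm (f t))" for f :: "real \<Rightarrow> 'z::real_normed_vector"
  proof -
    have "(\<lambda>t. ennreal (indicator {0..T} t *\<^sub>R norm (f t))) \<in> borel_measurable lborel"
      using that unfolding set_borel_measurable_def by measurable
    also have "(\<lambda>t. ennreal (indicator {0..T} t *\<^sub>R norm (f t))) = (\<lambda>t. ennreal (norm (f t)) * indicator {0..T} t)"
      by (auto simp: indicator_def)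
    finally show ?thesis .
  qed
  have "L1_norm T c \<le> (\<integral>\<^sup>+t. ennreal (norm (a t)) * indicator {0..T} t
      + ennreal (norm (b t)) * indicator {0..T} t \<partial>lborel)"
    unfolding L1_norm_eq using le
    by (intro nn_integral_mono) (auto simp: indicator_def ennreal_leI simp flip: ennreal_plus)
  also have "\<dots> = L1_norm T a + L1_norm T b"
    unfolding L1_norm_eq by (intro nn_integral_add meas a b)
  finally show ?thesis .
qed

text \<open>Splitting the square of the sum costs a factor 4, whose root is the 2 in front of
  \<open>K\<close>. The weight \<open>j\<close> is kept apart from \<open>K\<close> because it will
  be the operator norm of \<open>I - J_h\<close>, which depends on h and must stay visible in the
  bound.\<close>

lemma L2_norm_add_le:
  assumes le: "\<And>t. t \<in> {0..T} \<Longrightarrow> norm (c t) \<le> K * (norm (a t) + j * norm (b t))"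
    and K: "0 \<le> K" and j: "0 \<le> j"
    and a: "set_borel_measurable borel {0..T} (\<lambda>t. norm (a t))"
    and b: "set_borel_measurable borel {0..T} (\<lambda>t. norm (b t))"
  shows "L2_norm T c \<le> ennreal (2 * K) * (L2_norm T a + ennreal j * L2_norm T b)"
proof -
  have meas: "(\<lambda>t. ennreal ((norm (f t))\<^sup>2) * indicator {0..T} t) \<in> borel_measurable lborel"
    if "set_borel_measurable borel {0..T} (\<lambda>t. norm (f t))" for f :: "real \<Rightarrow> 'z::real_normed_vector"
  proof -
    have "(\<lambda>t. ennreal ((indicator {0..T} t *\<^sub>R norm (f t))\<^sup>2)) \<in> borel_measurable lborel"
      using that unfolding set_borel_measurable_def by measurable
    also have "(\<lambda>t. ennreal ((indicator {0..T} t *\<^sub>R norm (f t))\<^sup>2))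
        = (\<lambda>t. ennreal ((norm (f t))\<^sup>2) * indicator {0..T} t)"
      by (auto simp: indicator_def)
    finally show ?thesis .
  qed
  let ?p = "2 * K" and ?q = "2 * K * j"
  have pointwise: "ennreal ((norm (c t))\<^sup>2)
      \<le> ennreal (?p\<^sup>2) * ennreal ((norm (a t))\<^sup>2) + ennreal (?q\<^sup>2) * ennreal ((norm (b t))\<^sup>2)"
    if "t \<in> {0..T}" for t
  proof -
    let ?x = "norm (a t)" and ?y = "j * norm (b t)"
    have "(norm (c t))\<^sup>2 \<le> (K * (?x + ?y))\<^sup>2" using le[OF that] by (intro power_mono) auto
    also have "\<dots> = K\<^sup>2 * (?x + ?y)\<^sup>2" by (simp add: power_mult_distrib)
    also have "\<dots> \<le> K\<^sup>2 * (4 * ?x\<^sup>2 + 4 * ?y\<^sup>2)"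
    proof (intro mult_left_mono)
      have "0 \<le> (?x - ?y)\<^sup>2" by simp
      then show "(?x + ?y)\<^sup>2 \<le> 4 * ?x\<^sup>2 + 4 * ?y\<^sup>2"
        using zero_le_power2[of ?x] zero_le_power2[of ?y] unfolding power2_sum power2_diff by linarith
    qed simp
    also have "\<dots> = ?p\<^sup>2 * ?x\<^sup>2 + ?q\<^sup>2 * (norm (b t))\<^sup>2"
      by (simp add: power_mult_distrib algebra_simps)
    finally show ?thesis
      by (simp add: ennreal_leI flip: ennreal_plus ennreal_mult)
  qed
  let ?I = "\<lambda>f. \<integral>\<^sup>+t\<in>{0..T}. ennreal ((f t)\<^sup>2) \<partial>lborel"
  have "?I (\<lambda>t. norm (c t)) \<le> (\<integral>\<^sup>+t. ennreal (?p\<^sup>2) * (ennreal ((norm (a t))\<^sup>2) * indicator {0..T} t)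
      + ennreal (?q\<^sup>2) * (ennreal ((norm (b t))\<^sup>2) * indicator {0..T} t) \<partial>lborel)"
    using pointwise by (intro nn_integral_mono) (auto simp: indicator_def)
  also have "\<dots> = ennreal (?p\<^sup>2) * ?I (\<lambda>t. norm (a t)) + ennreal (?q\<^sup>2) * ?I (\<lambda>t. norm (b t))"
    using meas[OF a] meas[OF b] by (subst nn_integral_add) (auto simp: nn_integral_cmult)
  finally have "ennsqrt (?I (\<lambda>t. norm (c t)))
      \<le> ennreal ?p * ennsqrt (?I (\<lambda>t. norm (a t))) + ennreal ?q * ennsqrt (?I (\<lambda>t. norm (b t)))"
    using K j by (intro ennsqrt_le) auto
  then show ?thesis
    unfolding L2_norm_eq using K j by (simp add: ennreal_mult distrib_left mult.assoc)
qed

lemma L1_norm_add3_le: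
  assumes le: "\<And>t. t \<in> {0..T} \<Longrightarrow> norm (v t) \<le> norm (a t) + norm (b t) + norm (c t)"
    and a: "set_borel_measurable borel {0..T} (\<lambda>t. norm (a t))"
    and b: "set_borel_measurable borel {0..T} (\<lambda>t. norm (b t))"
    and c: "set_borel_measurable borel {0..T} (\<lambda>t. norm (c t))"
  shows "L1_norm T v \<le> L1_norm T a + L1_norm T b + L1_norm T c"
proof -
  have "L1_norm T v \<le> L1_norm T a + L1_norm T (\<lambda>t. norm (b t) + norm (c t))"
    using le set_borel_measurable_add[OF b c] by (intro L1_norm_add_le a) (auto simp: add.assoc)
  also have "L1_norm T (\<lambda>t. norm (b t) + norm (c t)) \<le> L1_norm T b + L1_norm T c"
    by (intro L1_norm_add_le b c) auto
  finally show ?thesis by (simp add: add.assoc add_left_mono)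
qed

lemma L2_norm_add2_le:
  assumes le: "\<And>t. t \<in> {0..T} \<Longrightarrow> norm (v t) \<le> norm (a t) + norm (b t)"
    and a: "set_borel_measurable borel {0..T} (\<lambda>t. norm (a t))"
    and b: "set_borel_measurable borel {0..T} (\<lambda>t. norm (b t))"
  shows "L2_norm T v \<le> 2 * (L2_norm T a + L2_norm T b)"
  using L2_norm_add_le[where c = v and a = a and b = b and K = 1 and j = 1 and T = T] assms by simp

text \<open>Two applications of the two-term bound give 2 * 2 = 4; the coefficient 2 of the first
  term is simply enlarged.\<close>

lemma L2_norm_add3_le:
  assumes le: "\<And>t. t \<in> {0..T} \<Longrightarrow> norm (v t) \<le> norm (a t) + norm (b t) + norm (c t)"
    and a: "set_borel_measurable borel {0..T} (\<lambda>t. norm (a t))"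
    and b: "set_borel_measurable borel {0..T} (\<lambda>t. norm (b t))"
    and c: "set_borel_measurable borel {0..T} (\<lambda>t. norm (c t))"
  shows "L2_norm T v \<le> 4 * (L2_norm T a + L2_norm T b + L2_norm T c)"
proof -
  have "L2_norm T v \<le> 2 * (L2_norm T a + L2_norm T (\<lambda>t. norm (b t) + norm (c t)))"
    using le set_borel_measurable_add[OF b c] by (intro L2_norm_add2_le a) (auto simp: add.assoc)
  also have "\<dots> \<le> 2 * (2 * L2_norm T a + 2 * (L2_norm T b + L2_norm T c))"
    using mult_right_mono[of 1 2 "L2_norm T a"]
    by (intro mult_left_mono add_mono L2_norm_add2_le b c) auto
  also have "\<dots> = 4 * (L2_norm T a + L2_norm T b + L2_norm T c)"
    by (simp add: distrib_left mult.assoc[symmetric] add.assoc)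
  finally show ?thesis .
qed

section \<open>Differentiable curves and inner products\<close>

lemma orth_basis_weakly_tdifferentiable:
  assumes C: "orth_basis S C" and v: "\<And>t. t \<in> {0..T} \<Longrightarrow> v t \<in> S"
    and diff: "\<And>c. c \<in> C \<Longrightarrow> tdifferentiable T (\<lambda>t. v t \<bullet> c)"
  shows "tdifferentiable T v"
proof (rule tdifferentiableI)
  fix t assume t: "t \<in> {0..T}"
  have "((\<lambda>t. \<Sum>c\<in>C. (v t \<bullet> c) *\<^sub>R ((1 / (c \<bullet> c)) *\<^sub>R c)) has_vector_derivative
      (\<Sum>c\<in>C. tderiv T (\<lambda>t. v t \<bullet> c) t *\<^sub>R ((1 / (c \<bullet> c)) *\<^sub>R c))) (at t within {0..T})"
    by (intro has_vector_derivative_sum bounded_linear.has_vector_derivative[OF bounded_linear_scaleR_left]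
        tderiv_works[OF diff t])
  then show "(v has_vector_derivative (\<Sum>c\<in>C. tderiv T (\<lambda>t. v t \<bullet> c) t *\<^sub>R ((1 / (c \<bullet> c)) *\<^sub>R c)))
      (at t within {0..T})"
    by (rule has_vector_derivative_transform[OF t, rotated])
       (subst orth_basis_expansion[OF C v], auto)
qed

lemma has_vector_derivative_inner_self:
  assumes "(v has_vector_derivative v') (at t within S)"
  shows "((\<lambda>s. v s \<bullet> v s) has_vector_derivative 2 * (v t \<bullet> v')) (at t within S)"
  using bounded_bilinear.has_vector_derivative[OF bounded_bilinear_inner assms assms]
  by (simp add: inner_commute)

text \<open>Young's inequality with one \<open>b \<bullet> b\<close> to spare. In the energy
  estimates \<open>b\<close> is a time derivative, which is thereby absorbed and leaves only the
  data \<open>a\<close>.\<close>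

lemma two_inner_diff_le:
  fixes a b :: "'a::real_inner"
  shows "2 * (a \<bullet> b - b \<bullet> b) \<le> a \<bullet> a"
proof -
  have "(a - b) \<bullet> (a - b) + b \<bullet> b = a \<bullet> a - 2 * (a \<bullet> b - b \<bullet> b)"
    by (simp add: inner_diff_left inner_diff_right inner_commute algebra_simps)
  then show ?thesis
    using inner_ge_zero[of "a - b"] inner_ge_zero[of b] by linarith
qed

subsection \<open>Finite-dimensional complexes\<close>

context findim_hilbert_complex
begin

lemma orth_basis_V: "\<exists>C. orth_basis (V k) C"
proof -
  obtain B where B: "finite B" "W k = span B" using findim by blast
  obtain B' where B': "B' \<subseteq> V k" "independent B'" "V k \<subseteq> span B'"
    using maximal_independent_subset by blast
  have "finite B'"
    using B B' V_subset_W independent_span_bound by (metis subset_trans)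
  moreover have "V k = span B'"
    using B' subspace_V span_minimal by blast
  ultimately show ?thesis by (rule orth_basis_exists)
qed

lemma projectable_V: "projectable (V k)"
  using orth_basis_V orth_basis_projectable by blast

text \<open>A dense subspace that is closed is everything. Discrete differentials and their adjoints
  therefore act on the whole discrete space and raise no domain questions.\<close>

lemma W_eq_V: "W k = V k"
  using V_dense[of k] V_subset_W[of k] projectable_closed[OF projectable_V, of k] by simp

lemma d_pred_linear: "linear_between (V (k - 1)) (V k) (d (k - 1))"
  using d_linear[of "k - 1"] by simp

lemma d_bounded: "\<exists>M. \<forall>x\<in>V k. norm (d k x) \<le> M * norm x"
  using orth_basis_V orth_basis_bounded[OF _ d_linear] by blast

lemma d_pred_in: "v \<in> V (k - 1) \<Longrightarrow> d (k - 1) v \<in> V k"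
  by (rule linear_betweenD(1)[OF d_pred_linear])

lemma dstar_eq_adj: "dstar W V d k = adj (V (k - 1)) (V (k - 1)) (d (k - 1))"
  by (simp add: dstar_def W_eq_V)

lemma dstar_in: "dstar W V d k y \<in> V (k - 1)"
  using orth_basis_V adj_findim_in[OF _ d_pred_linear] by (metis dstar_eq_adj)

lemma dstar_inner: "v \<in> V (k - 1) \<Longrightarrow> d (k - 1) v \<bullet> y = v \<bullet> dstar W V d k y"
  using orth_basis_V adj_findim_inner[OF _ d_pred_linear] by (metis dstar_eq_adj)

lemma dstar_succ_in: "dstar W V d (k + 1) y \<in> V k"
  using dstar_in[of "k + 1"] by simp

lemma dstar_succ_inner: "v \<in> V k \<Longrightarrow> d k v \<bullet> y = v \<bullet> dstar W V d (k + 1) y"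
  using dstar_inner[of v "k + 1"] by simp

lemma bounded_linear_dstar: "bounded_linear (dstar W V d k)"
  using orth_basis_V bounded_linear_adj_findim[OF _ d_pred_linear] by (metis dstar_eq_adj)

lemma dstar_eqI:
  assumes "x \<in> V (k - 1)" "\<And>v. v \<in> V (k - 1) \<Longrightarrow> d (k - 1) v \<bullet> y = v \<bullet> x"
  shows "dstar W V d k y = x"
  unfolding dstar_eq_adj using assms closure_subset subspace_V by (intro adj_eqI) auto

lemma dstar_harmonic:
  assumes "q \<in> harmonics V d k"
  shows "dstar W V d k q = 0"
proof (rule dstar_eqI)
  show "0 \<in> V (k - 1)" using subspace_V by (rule subspace_0)
  show "d (k - 1) v \<bullet> q = v \<bullet> 0" if "v \<in> V (k - 1)" for v
    using assms that by (auto simp: harmonics_def coboundaries_def orthogonal_def inner_commute)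
qed

lemma harmonicD:
  assumes "q \<in> harmonics V d k"
  shows "q \<in> V k" "d k q = 0" "v \<in> V (k - 1) \<Longrightarrow> d (k - 1) v \<bullet> q = 0"
  using assms by (auto simp: harmonics_def cocycles_def coboundaries_def orthogonal_def inner_commute)

lemma harmonicI:
  assumes "q \<in> V k" "d k q = 0" "dstar W V d k q = 0"
  shows "q \<in> harmonics V d k"
  using assms dstar_inner[of _ k q]
  by (auto simp: harmonics_def cocycles_def coboundaries_def orthogonal_def inner_commute)

text \<open>The orthogonal complement of the range of the Hodge Laplacian consists of harmonic elements.\<close>

lemma hodge_laplacian_decomposition:
  assumes \<phi>: "\<phi> \<in> V k"
  shows "\<exists>q\<in>harmonics V d k. \<exists>w\<in>V k.
    \<phi> = q + (d (k - 1) (dstar W V d k w) + dstar W V d (k + 1) (d k w))"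
proof -
  define L where "L w = d (k - 1) (dstar W V d k w) + dstar W V d (k + 1) (d k w)" for w
  interpret ds: bounded_linear "dstar W V d j" for j by (rule bounded_linear_dstar)
  have L: "linear_between (V k) (V k) L"
    unfolding linear_between_def L_def
    using d_pred_in dstar_in dstar_succ_in subspace_V
    by (auto simp: subspace_add ds.add ds.scaleR linear_betweenD(2,3)[OF d_linear]
        linear_betweenD(2,3)[OF d_pred_linear] scaleR_right_distrib)
  obtain C where C: "orth_basis (V k) C" using orth_basis_V by blast
  have sub: "subspace (L ` V k)"
    unfolding subspace_def
  proof (intro conjI ballI allI)
    show "0 \<in> L ` V k"
      using subspace_0[OF subspace_V] linear_betweenD(3)[OF L, of 0 0] by (metis image_eqI scaleR_zero_left)
  next
    fix x y assume "x \<in> L ` V k" "y \<in> L ` V k"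
    then show "x + y \<in> L ` V k"
      using linear_betweenD(2)[OF L] subspace_add[OF subspace_V] by (smt (verit) image_iff)
  next
    fix c x assume "x \<in> L ` V k"
    then show "c *\<^sub>R x \<in> L ` V k"
      using linear_betweenD(3)[OF L] subspace_scale[OF subspace_V] by (smt (verit) image_iff)
  qed
  have "L ` V k \<subseteq> span (L ` C)"
    using orth_basis_linear[OF C L] by (auto intro!: span_sum span_scale intro: span_base)
  moreover have "span (L ` C) \<subseteq> L ` V k"
    using orth_basis_subset[OF C] sub by (intro span_minimal) auto
  ultimately have "L ` V k = span (L ` C)" by blast
  moreover have "finite (L ` C)" using C by (simp add: orth_basis_def)
  ultimately have R: "projectable (L ` V k)"
    using orth_basis_exists orth_basis_projectable by blast
  obtain w where w: "w \<in> V k" "orth_proj (L ` V k) \<phi> = L w"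
    using orth_proj_in[OF R, of \<phi>] by blast
  define n where "n = \<phi> - L w"
  have n: "n \<in> V k"
    unfolding n_def using linear_betweenD(1)[OF L w(1)] \<phi> subspace_V by (simp add: subspace_diff)
  \<comment> \<open>\<open>n\<close> is orthogonal to the range of \<open>L\<close>, in particular
    to \<open>L n\<close>; this pairing is a sum of two squares, which forces \<open>n\<close> to be
    harmonic.\<close>
  have "n \<bullet> L n = 0"
    using orth_proj_orthogonal[OF R, of "L n" \<phi>] n w by (simp add: n_def)
  moreover have "n \<bullet> L n = dstar W V d k n \<bullet> dstar W V d k n + d k n \<bullet> d k n"
    using dstar_inner[OF dstar_in, of k n n] dstar_succ_inner[OF n, of "d k n"]
    by (simp add: L_def inner_add_right inner_commute)
  ultimately have "dstar W V d k n = 0" "d k n = 0"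
    using inner_ge_zero[of "dstar W V d k n"] inner_ge_zero[of "d k n"] inner_eq_zero_iff
    by (smt (verit))+
  then have "n \<in> harmonics V d k" using n by (intro harmonicI)
  moreover have "\<phi> = n + L w" by (simp add: n_def)
  ultimately show ?thesis using w(1) unfolding L_def by blast
qed

text \<open>Testing with the decomposition \<open>\<phi> = q + L w\<close>, \<open>L\<close> the Hodge Laplacian, expresses the
  pairings of the solution with \<open>\<phi>\<close> through the data.\<close>

lemma elliptic_tdifferentiable:
  assumes r: "tdifferentiable T r" and z: "tdifferentiable T z"
    and s_in: "\<And>t. t \<in> {0..T} \<Longrightarrow> s t \<in> V (k - 1)"
    and u_in: "\<And>t. t \<in> {0..T} \<Longrightarrow> u t \<in> V k"
    and p_in: "\<And>t. t \<in> {0..T} \<Longrightarrow> p t \<in> harmonics V d k"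
    and s: "\<And>t \<omega>. t \<in> {0..T} \<Longrightarrow> \<omega> \<in> V (k - 1) \<Longrightarrow> s t \<bullet> \<omega> = u t \<bullet> d (k - 1) \<omega>"
    and eq: "\<And>t \<phi>. t \<in> {0..T} \<Longrightarrow> \<phi> \<in> V k \<Longrightarrow>
        d (k - 1) (s t) \<bullet> \<phi> + d k (u t) \<bullet> d k \<phi> + p t \<bullet> \<phi> = r t \<bullet> \<phi>"
    and q: "\<And>t q. t \<in> {0..T} \<Longrightarrow> q \<in> harmonics V d k \<Longrightarrow> u t \<bullet> q = z t \<bullet> q"
  shows "tdifferentiable T p" "tdifferentiable T u" "tdifferentiable T s"
proof -
  obtain C where C: "orth_basis (V k) C" using orth_basis_V by blast
  have inner_diff: "tdifferentiable T (\<lambda>t. v t \<bullet> c)" if "tdifferentiable T v" for v and c :: 'a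
    using bounded_linear.has_vector_derivative[OF bounded_linear_inner_left tderiv_works[OF that]]
    by (rule tdifferentiableI)
  have cong: "tdifferentiable T a" if "tdifferentiable T b" "\<And>t. t \<in> {0..T} \<Longrightarrow> a t = b t"
    for a b :: "real \<Rightarrow> 'b::real_normed_vector"
    using has_vector_derivative_transform[OF _ that(2) tderiv_works[OF that(1)]]
    by (rule tdifferentiableI)
  have p_diff: "tdifferentiable T (\<lambda>t. p t \<bullet> c)" if "c \<in> V k" for c
  proof -
    obtain q w where qw: "q \<in> harmonics V d k" "w \<in> V k"
      "c = q + (d (k - 1) (dstar W V d k w) + dstar W V d (k + 1) (d k w))"
      using hodge_laplacian_decomposition[OF \<open>c \<in> V k\<close>] by blast
    \<comment> \<open>\<open>p t\<close> is orthogonal to the Laplacian part of \<open>c\<close>,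
      which leaves the pairing with \<open>q\<close>; the equation tested with the harmonic
      \<open>q\<close> loses its first two terms.\<close>
    have "p t \<bullet> c = r t \<bullet> q" if t: "t \<in> {0..T}" for t
    proof -
      note p = harmonicD[OF p_in[OF t]]
      have "p t \<bullet> d (k - 1) (dstar W V d k w) = 0"
        using p(3)[OF dstar_in] by (simp add: inner_commute)
      moreover have "p t \<bullet> dstar W V d (k + 1) (d k w) = 0"
        using dstar_succ_inner[OF p(1)] p(2) by (metis inner_zero_left)
      ultimately have "p t \<bullet> c = p t \<bullet> q" by (simp add: qw(3) inner_add_right)
      then show ?thesis
        using eq[OF t harmonicD(1)[OF qw(1)]] harmonicD(2,3)[OF qw(1)] s_in[OF t] by simp
    qed
    then show ?thesis by (rule cong[OF inner_diff[OF r]])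
  qed
  show p: "tdifferentiable T p"
    by (rule orth_basis_weakly_tdifferentiable[OF C harmonicD(1)[OF p_in] p_diff])
       (use orth_basis_subset[OF C] in auto)
  show u: "tdifferentiable T u"
  proof (rule orth_basis_weakly_tdifferentiable[OF C u_in])
    fix c assume "c \<in> C"
    then have "c \<in> V k" by (rule orth_basis_subset[OF C])
    then obtain q w where qw: "q \<in> harmonics V d k" "w \<in> V k"
      "c = q + (d (k - 1) (dstar W V d k w) + dstar W V d (k + 1) (d k w))"
      using hodge_laplacian_decomposition by blast
    \<comment> \<open>Moving the Hodge Laplacian from \<open>w\<close> to \<open>u t\<close>
      produces the left-hand side of the equation tested with \<open>w\<close>, up to the term in
      \<open>p t\<close>. This is why \<open>p\<close> is treated before \<open>u\<close>.\<close>
    have u_eq: "u t \<bullet> c = z t \<bullet> q + r t \<bullet> w - p t \<bullet> w" if t: "t \<in> {0..T}" for t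
    proof -
      have "u t \<bullet> d (k - 1) (dstar W V d k w) = d (k - 1) (s t) \<bullet> w"
        using s[OF t dstar_in] dstar_inner[OF s_in[OF t], of w] by simp
      moreover have "u t \<bullet> dstar W V d (k + 1) (d k w) = d k (u t) \<bullet> d k w"
        using dstar_succ_inner[OF u_in[OF t]] by simp
      ultimately show ?thesis
        using eq[OF t qw(2)] q[OF t qw(1)] by (simp add: qw(3) inner_add_right)
    qed
    have "tdifferentiable T (\<lambda>t. z t \<bullet> q + r t \<bullet> w - p t \<bullet> w)"
      using has_vector_derivative_diff[OF has_vector_derivative_add[OF
            tderiv_works[OF inner_diff[OF z]] tderiv_works[OF inner_diff[OF r]]]
          tderiv_works[OF inner_diff[OF p]]]
      by (rule tdifferentiableI)
    then show "tdifferentiable T (\<lambda>t. u t \<bullet> c)" using u_eq by (rule cong)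
  qed
  have s_eq: "s t = dstar W V d k (u t)" if "t \<in> {0..T}" for t
    using s[OF that] s_in[OF that] by (intro dstar_eqI[symmetric]) (auto simp: inner_commute)
  have "tdifferentiable T (\<lambda>t. dstar W V d k (u t))"
    using bounded_linear.has_vector_derivative[OF bounded_linear_dstar tderiv_works[OF u]]
    by (rule tdifferentiableI)
  then show "tdifferentiable T s" using s_eq by (rule cong)
qed

section \<open>Energy estimates for the error equation\<close>

context
  fixes T :: real and k :: int and \<theta> \<epsilon> F :: "real \<Rightarrow> 'a" and N :: "real \<Rightarrow> real"
  assumes T: "0 < T" and \<theta>: "tdifferentiable T \<theta>" and \<theta>0: "\<theta> 0 = 0"
    and \<theta>_in: "\<And>t. t \<in> {0..T} \<Longrightarrow> \<theta> t \<in> V k"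
    and \<epsilon>_in: "\<And>t. t \<in> {0..T} \<Longrightarrow> \<epsilon> t \<in> V (k - 1)"
    and \<epsilon>: "\<And>t \<omega>. t \<in> {0..T} \<Longrightarrow> \<omega> \<in> V (k - 1) \<Longrightarrow> \<epsilon> t \<bullet> \<omega> = \<theta> t \<bullet> d (k - 1) \<omega>"
    and eq: "\<And>t \<phi>. t \<in> {0..T} \<Longrightarrow> \<phi> \<in> V k \<Longrightarrow>
        tderiv T \<theta> t \<bullet> \<phi> + d (k - 1) (\<epsilon> t) \<bullet> \<phi> + d k (\<theta> t) \<bullet> d k \<phi> = F t \<bullet> \<phi>"
    and N: "set_borel_measurable borel {0..T} N"
begin

lemma energy_theta_deriv_in: "t \<in> {0..T} \<Longrightarrow> tderiv T \<theta> t \<in> V k"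
  using projectable_has_vector_derivative_in[OF projectable_V T \<theta>_in _ tderiv_works[OF \<theta>]] by blast

lemma energy_epsilon_eq: "t \<in> {0..T} \<Longrightarrow> \<epsilon> t = dstar W V d k (\<theta> t)"
  using \<epsilon> \<epsilon>_in by (intro dstar_eqI[symmetric]) (auto simp: inner_commute)

text \<open>\<epsilon> is not assumed differentiable; it inherits a derivative from \<theta> through
  the bounded adjoint.\<close>

lemma energy_epsilon_deriv:
  assumes t: "t \<in> {0..T}"
  shows "(\<epsilon> has_vector_derivative dstar W V d k (tderiv T \<theta> t)) (at t within {0..T})"
  using bounded_linear.has_vector_derivative[OF bounded_linear_dstar tderiv_works[OF \<theta> t]]
  by (rule has_vector_derivative_transform[OF t, rotated]) (rule energy_epsilon_eq)

text \<open>The norm is not differentiable at 0, so the root of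
  \<open>\<theta> s \<bullet> \<theta> s + e\<^sup>2\<close> is differentiated instead, and e tends
  to 0 at the end. Working with this root rather than with squares yields the L1 norm with constant
  1. Measurability is asked of the majorant \<open>N\<close>, which is a sum of norms in the
  application.\<close>

lemma energy_theta:
  assumes F: "\<And>t. t \<in> {0..T} \<Longrightarrow> norm (F t) \<le> N t" and t: "t \<in> {0..T}"
  shows "ennreal (norm (\<theta> t)) \<le> L1_norm T N"
proof -
  have N0: "0 \<le> N s" if "s \<in> {0..T}" for s using F[OF that] norm_ge_zero order_trans by blast
  have L1: "L1_norm T N = (\<integral>\<^sup>+s\<in>{0..T}. ennreal (N s) \<partial>lborel)"
    unfolding L1_norm_eq using N0 by (intro nn_integral_cong) (auto simp: indicator_def)
  have shifted: "ennreal (sqrt (\<theta> t \<bullet> \<theta> t + e\<^sup>2) - e) \<le> L1_norm T N" if "e > 0" for e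
  proof -
    let ?\<phi> = "\<lambda>s. sqrt (\<theta> s \<bullet> \<theta> s + e\<^sup>2)"
    have pos: "\<theta> s \<bullet> \<theta> s + e\<^sup>2 > 0" for s using \<open>e > 0\<close> by (simp add: add_nonneg_pos)
    have deriv: "(?\<phi> has_vector_derivative (\<theta> s \<bullet> tderiv T \<theta> s) / ?\<phi> s) (at s within {0..T})"
      if s: "s \<in> {0..T}" for s
    proof -
      have "((\<lambda>s. \<theta> s \<bullet> \<theta> s + e\<^sup>2) has_real_derivative 2 * (\<theta> s \<bullet> tderiv T \<theta> s)) (at s within {0..T})"
        using has_vector_derivative_inner_self[OF tderiv_works[OF \<theta> s]]
        by (simp add: has_real_derivative_iff_has_vector_derivative has_vector_derivative_add_const)
      from DERIV_chain2[OF DERIV_real_sqrt[OF pos] this] show ?thesis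
        by (simp add: has_real_derivative_iff_has_vector_derivative field_simps)
    qed
    \<comment> \<open>Testing with \<open>\<theta> s\<close> leaves two nonnegative squares, which
      are dropped; \<open>norm (\<theta> s)\<close> is at most the regularized root and cancels
      against it.\<close>
    have le: "(\<theta> s \<bullet> tderiv T \<theta> s) / ?\<phi> s \<le> N s" if s: "s \<in> {0..T}" for s
    proof -
      have "d (k - 1) (\<epsilon> s) \<bullet> \<theta> s = \<epsilon> s \<bullet> \<epsilon> s"
        using \<epsilon>[OF s \<epsilon>_in[OF s]] by (simp add: inner_commute)
      then have "\<theta> s \<bullet> tderiv T \<theta> s \<le> F s \<bullet> \<theta> s"
        using eq[OF s \<theta>_in[OF s]] inner_ge_zero[of "\<epsilon> s"] inner_ge_zero[of "d k (\<theta> s)"]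
        unfolding inner_commute[of "\<theta> s" "tderiv T \<theta> s"] by linarith
      also have "\<dots> \<le> norm (F s) * norm (\<theta> s)" by (rule norm_cauchy_schwarz)
      also have "\<dots> \<le> N s * ?\<phi> s"
        using F[OF s] N0[OF s] unfolding norm_eq_sqrt_inner[of "\<theta> s"] by (intro mult_mono) auto
      finally show ?thesis using pos[of s] by (simp add: divide_le_eq)
    qed
    have "ennreal (?\<phi> t - ?\<phi> 0) \<le> (\<integral>\<^sup>+s\<in>{0..T}. ennreal (N s) \<partial>lborel)"
      by (rule has_vector_derivative_le_imp_nn_integral[OF deriv le N0 N t])
    then show ?thesis using \<open>e > 0\<close> by (simp add: L1 \<theta>0)
  qed
  show ?thesis
  proof (cases "L1_norm T N")
    case (real r)
    have "norm (\<theta> t) \<le> r + e" if "e > 0" for e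
    proof -
      have "norm (\<theta> t) \<le> sqrt (\<theta> t \<bullet> \<theta> t + e\<^sup>2)" by (simp add: norm_eq_sqrt_inner)
      moreover have "sqrt (\<theta> t \<bullet> \<theta> t + e\<^sup>2) - e \<le> r"
        using shifted[OF that] real by (simp add: ennreal_le_iff)
      ultimately show ?thesis by simp
    qed
    then have "norm (\<theta> t) \<le> r" by (rule field_le_epsilon)
    then show ?thesis using real by (simp add: ennreal_leI)
  qed simp
qed

text \<open>Tested with the time derivative of \<theta>, the terms containing \<open>d\<close> are
  half the derivative of \<open>?\<phi>\<close>, because \<epsilon> is the adjoint image of
  \<theta>. Twice the remaining terms is at most \<open>F s \<bullet> F s\<close> by
  \<open>two_inner_diff_le\<close>.\<close>

lemma energy_d_theta_epsilon:
  assumes F: "\<And>t. t \<in> {0..T} \<Longrightarrow> norm (F t) \<le> N t" and t: "t \<in> {0..T}"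
  shows "ennreal (norm (d k (\<theta> t)) + norm (\<epsilon> t)) \<le> 2 * L2_norm T N"
proof -
  let ?\<phi> = "\<lambda>s. \<epsilon> s \<bullet> \<epsilon> s + d k (\<theta> s) \<bullet> d k (\<theta> s)"
  let ?\<phi>' = "\<lambda>s. 2 * (\<epsilon> s \<bullet> dstar W V d k (tderiv T \<theta> s)) + 2 * (d k (\<theta> s) \<bullet> d k (tderiv T \<theta> s))"
  have deriv: "(?\<phi> has_vector_derivative ?\<phi>' s) (at s within {0..T})" if s: "s \<in> {0..T}" for s
    using has_vector_derivative_linear_between[OF projectable_V T \<theta>_in s tderiv_works[OF \<theta> s] d_linear d_bounded]
    by (intro has_vector_derivative_add has_vector_derivative_inner_self energy_epsilon_deriv[OF s])
  have le: "?\<phi>' s \<le> (norm (N s))\<^sup>2" if s: "s \<in> {0..T}" for s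
  proof -
    let ?\<theta>' = "tderiv T \<theta> s"
    have "\<epsilon> s \<bullet> dstar W V d k ?\<theta>' = d (k - 1) (\<epsilon> s) \<bullet> ?\<theta>'"
      using dstar_inner[OF \<epsilon>_in[OF s]] by simp
    then have "?\<phi>' s = 2 * (F s \<bullet> ?\<theta>' - ?\<theta>' \<bullet> ?\<theta>')"
      using eq[OF s energy_theta_deriv_in[OF s]] by simp
    also have "\<dots> \<le> F s \<bullet> F s"
      by (rule two_inner_diff_le)
    also have "\<dots> \<le> (norm (N s))\<^sup>2"
      using F[OF s] unfolding dot_square_norm by (intro power_mono) auto
    finally show ?thesis .
  qed
  interpret ds: bounded_linear "dstar W V d k" by (rule bounded_linear_dstar)
  have "d k 0 = 0"
    using linear_betweenD(3)[OF d_linear subspace_0[OF subspace_V], of k 0] by simp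
  then have "?\<phi> 0 = 0" using energy_epsilon_eq[of 0] \<theta>0 ds.zero T by simp
  moreover have "ennreal (?\<phi> t - ?\<phi> 0) \<le> (\<integral>\<^sup>+s\<in>{0..T}. ennreal ((norm (N s))\<^sup>2) \<partial>lborel)"
    by (rule has_vector_derivative_le_imp_nn_integral[OF deriv le _ set_borel_measurable_norm_power2[OF N] t]) auto
  ultimately have int: "ennreal (?\<phi> t) \<le> (\<integral>\<^sup>+s\<in>{0..T}. ennreal ((norm (N s))\<^sup>2) \<partial>lborel)"
    by simp
  let ?a = "norm (d k (\<theta> t))" and ?b = "norm (\<epsilon> t)"
  \<comment> \<open>The source of the factor 2: the sum of the two norms is at most twice the root
    of the sum of their squares.\<close>
  have "((?a + ?b) / 2)\<^sup>2 \<le> ?\<phi> t"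
  proof -
    have "4 * (?a\<^sup>2 + ?b\<^sup>2) - (?a + ?b)\<^sup>2 = 2 * ?a\<^sup>2 + 2 * ?b\<^sup>2 + (?a - ?b)\<^sup>2"
      by (simp add: power2_eq_square algebra_simps)
    moreover have "0 \<le> 2 * ?a\<^sup>2 + 2 * ?b\<^sup>2 + (?a - ?b)\<^sup>2" by simp
    ultimately have "(?a + ?b)\<^sup>2 \<le> 4 * (?a\<^sup>2 + ?b\<^sup>2)" by (metis diff_ge_0_iff_ge)
    then have "((?a + ?b) / 2)\<^sup>2 \<le> ?a\<^sup>2 + ?b\<^sup>2" by (simp add: power_divide)
    then show ?thesis by (simp add: dot_square_norm add.commute)
  qed
  then have "ennreal ((?a + ?b) / 2) \<le> L2_norm T N"
    unfolding L2_norm_eq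
    by (intro le_ennsqrt order_trans[OF ennreal_leI int]) auto
  then have "ennreal 2 * ennreal ((?a + ?b) / 2) \<le> 2 * L2_norm T N"
    by (simp add: mult_left_mono)
  moreover have "ennreal 2 * ennreal ((?a + ?b) / 2) = ennreal (2 * ((?a + ?b) / 2))"
    by (rule ennreal_mult[symmetric]) auto
  moreover have "2 * ((?a + ?b) / 2) = ?a + ?b" by simp
  ultimately show ?thesis by metis
qed

text \<open>The test function is \<open>d\<close> of the time derivative of \<epsilon>: since
  \<open>d\<close> after \<open>d\<close> vanishes, the term in \<theta> drops out, and moving
  \<open>d\<close> to the other side replaces \<open>F\<close> by its adjoint image. Only that image
  is bounded here, so a harmonic part of \<open>F\<close> leaves no trace.\<close>

lemma energy_d_epsilon:
  assumes F: "\<And>t. t \<in> {0..T} \<Longrightarrow> norm (dstar W V d k (F t)) \<le> N t" and t: "t \<in> {0..T}"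
  shows "ennreal (norm (d (k - 1) (\<epsilon> t))) \<le> L2_norm T N"
proof -
  let ?\<phi> = "\<lambda>s. d (k - 1) (\<epsilon> s) \<bullet> d (k - 1) (\<epsilon> s)"
  let ?\<epsilon>' = "\<lambda>s. dstar W V d k (tderiv T \<theta> s)"
  let ?\<phi>' = "\<lambda>s. 2 * (d (k - 1) (\<epsilon> s) \<bullet> d (k - 1) (?\<epsilon>' s))"
  have deriv: "(?\<phi> has_vector_derivative ?\<phi>' s) (at s within {0..T})" if s: "s \<in> {0..T}" for s
    by (intro has_vector_derivative_inner_self
        has_vector_derivative_linear_between[OF projectable_V T \<epsilon>_in s energy_epsilon_deriv[OF s] d_linear d_bounded])
  have le: "?\<phi>' s \<le> (norm (N s))\<^sup>2" if s: "s \<in> {0..T}" for s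
  proof -
    let ?e = "?\<epsilon>' s" and ?G = "dstar W V d k (F s)"
    have "d k (d (k - 1) ?e) = 0" using d_d[OF dstar_in, of k] by simp
    then have "?e \<bullet> ?e + d (k - 1) (\<epsilon> s) \<bullet> d (k - 1) ?e = ?e \<bullet> ?G"
      using eq[OF s d_pred_in[OF dstar_in, of k "tderiv T \<theta> s"]]
        dstar_inner[OF dstar_in, of k "tderiv T \<theta> s" "F s"]
        dstar_inner[OF dstar_in, of k "tderiv T \<theta> s" "tderiv T \<theta> s"]
      by (simp add: inner_commute)
    then have "?\<phi>' s = 2 * (?G \<bullet> ?e - ?e \<bullet> ?e)" by (simp add: inner_commute)
    also have "\<dots> \<le> ?G \<bullet> ?G"
      by (rule two_inner_diff_le)
    also have "\<dots> \<le> (norm (N s))\<^sup>2"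
      using F[OF s] unfolding dot_square_norm by (intro power_mono) auto
    finally show ?thesis .
  qed
  interpret ds: bounded_linear "dstar W V d k" by (rule bounded_linear_dstar)
  have "d (k - 1) 0 = 0"
    using linear_betweenD(3)[OF d_linear subspace_0[OF subspace_V], of "k - 1" 0] by simp
  then have "?\<phi> 0 = 0" using energy_epsilon_eq[of 0] \<theta>0 ds.zero T by simp
  moreover have "ennreal (?\<phi> t - ?\<phi> 0) \<le> (\<integral>\<^sup>+s\<in>{0..T}. ennreal ((norm (N s))\<^sup>2) \<partial>lborel)"
    by (rule has_vector_derivative_le_imp_nn_integral[OF deriv le _ set_borel_measurable_norm_power2[OF N] t]) auto
  ultimately show ?thesis
    unfolding L2_norm_eq by (intro le_ennsqrt) (simp_all add: dot_square_norm)
qed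

end

end

subsection \<open>Hilbert complexes\<close>

context hilbert_complex
begin

lemma d_pred: "v \<in> V (k - 1) \<Longrightarrow> d (k - 1) v \<in> V k"
  using linear_betweenD(1)[OF d_linear, of v "k - 1"] by simp

text \<open>\<open>x\<close> and 0 are both the adjoint value at 0 of the zero map on the dense
  space \<open>V k\<close>.\<close>

lemma V_orthogonal_imp_zero:
  assumes "x \<in> W k" "\<And>\<phi>. \<phi> \<in> V k \<Longrightarrow> x \<bullet> \<phi> = 0"
  shows "x = 0"
proof -
  have "adj (V k) (W k) (\<lambda>_. 0 :: 'a) 0 = x"
    using assms by (intro adj_eqI V_dense subspace_W) (auto simp: inner_commute)
  moreover have "adj (V k) (W k) (\<lambda>_. 0 :: 'a) 0 = 0"
    by (intro adj_eqI V_dense subspace_W subspace_0) auto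
  ultimately show ?thesis by simp
qed

lemma dstar_unique:
  assumes "x \<in> W (k - 1)" "\<And>v. v \<in> V (k - 1) \<Longrightarrow> d (k - 1) v \<bullet> y = v \<bullet> x"
  shows "dstar W V d k y = x"
  unfolding dstar_def using assms by (intro adj_eqI V_dense subspace_W)

lemma dstar_domD:
  assumes "y \<in> dstar_dom W V d k"
  shows "dstar W V d k y \<in> W (k - 1)" "v \<in> V (k - 1) \<Longrightarrow> d (k - 1) v \<bullet> y = v \<bullet> dstar W V d k y"
proof -
  obtain x where x: "x \<in> W (k - 1)" "\<And>v. v \<in> V (k - 1) \<Longrightarrow> d (k - 1) v \<bullet> y = v \<bullet> x"
    using assms unfolding dstar_dom_def adj_dom_def by blast
  have "dstar W V d k y = x" using x by (rule dstar_unique)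
  with x show "dstar W V d k y \<in> W (k - 1)"
    "v \<in> V (k - 1) \<Longrightarrow> d (k - 1) v \<bullet> y = v \<bullet> dstar W V d k y" by auto
qed

lemma projectable_W: "projectable (W k)"
  using subspace_W complete_W by (rule complete_projectable)

text \<open>The kernel of the possibly unbounded \<open>d k\<close> is closed as the preimage of its
  closed graph under \<open>\<lambda>z. (z, 0)\<close>. The harmonic projection is then bounded and
  linear, which makes the projected solution differentiable in time.\<close>

lemma projectable_harmonics: "projectable (harmonics V d k)"
proof (rule complete_projectable)
  have eq: "harmonics V d k = W k \<inter> ((\<lambda>z. (z, 0)) -` (\<lambda>v. (v, d k v)) ` V k
      \<inter> (\<Inter>b\<in>coboundaries V d k. {z. z \<bullet> b = 0}))"
    using V_subset_W by (fastforce simp: harmonics_def cocycles_def orthogonal_def)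
  have "closed ((\<lambda>z. (z, 0)) -` (\<lambda>v. (v, d k v)) ` V k \<inter> (\<Inter>b\<in>coboundaries V d k. {z. z \<bullet> b = 0}))"
    by (intro closed_Int closed_INT ballI closed_vimage d_closed closed_Collect_eq continuous_intros)
  then show "complete (harmonics V d k)"
    unfolding eq by (intro complete_Int_closed complete_W)
  have "d k 0 = 0"
    using linear_betweenD(3)[OF d_linear subspace_0[OF subspace_V], of k 0] by simp
  then show "subspace (harmonics V d k)"
    using subspace_V[of k] linear_betweenD(2,3)[OF d_linear, of _ k]
    by (auto simp: subspace_def harmonics_def cocycles_def orthogonal_def inner_add_left)
qed

lemma harmonics_subset_W: "harmonics V d k \<subseteq> W k"
  using V_subset_W by (auto simp: harmonics_def cocycles_def)

lemma laplacian_in_W: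
  assumes "v \<in> laplacian_dom W V d k"
  shows "laplacian W V d k v \<in> W k"
proof -
  have "dstar W V d (k + 1) (d k v) \<in> W k"
    using dstar_domD(1)[of "d k v" "k + 1"] assms by (simp add: laplacian_dom_def)
  moreover have "d (k - 1) (dstar W V d k v) \<in> W k"
    using assms d_pred V_subset_W by (auto simp: laplacian_dom_def)
  ultimately show ?thesis
    unfolding laplacian_def by (intro subspace_neg subspace_add subspace_W)
qed

text \<open>\<open>V k\<close> is dense, so the weak equation determines the source as an element of
  \<open>W k\<close>. Interpolation acts on such elements and is not assumed to respect inner
  products, hence the need for an identity there.\<close>

lemma weak_solution_imp_strong:
  assumes u: "u \<in> laplacian_dom W V d k" and v: "v \<in> W k" and f: "f \<in> W k" and \<sigma>: "\<sigma> \<in> V (k - 1)"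
    and eq1: "\<And>\<omega>. \<omega> \<in> V (k - 1) \<Longrightarrow> \<sigma> \<bullet> \<omega> = u \<bullet> d (k - 1) \<omega>"
    and eq2: "\<And>\<phi>. \<phi> \<in> V k \<Longrightarrow> v \<bullet> \<phi> + d k u \<bullet> d k \<phi> + d (k - 1) \<sigma> \<bullet> \<phi> = f \<bullet> \<phi>"
  shows "f = v + - laplacian W V d k u"
proof -
  have "dstar W V d k u = \<sigma>"
    using \<sigma> V_subset_W eq1 by (intro dstar_unique) (auto simp: inner_commute)
  then have lap: "laplacian W V d k u = - (d (k - 1) \<sigma> + dstar W V d (k + 1) (d k u))"
    by (simp add: laplacian_def)
  have dd: "d k \<phi> \<bullet> d k u = \<phi> \<bullet> dstar W V d (k + 1) (d k u)" if "\<phi> \<in> V k" for \<phi>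
    using dstar_domD(2)[of "d k u" "k + 1" \<phi>] u that by (simp add: laplacian_dom_def)
  have "f - (v + - laplacian W V d k u) = 0"
  proof (rule V_orthogonal_imp_zero[where k = k])
    show "f - (v + - laplacian W V d k u) \<in> W k"
      by (intro subspace_diff subspace_add subspace_neg subspace_W laplacian_in_W f v u)
    show "(f - (v + - laplacian W V d k u)) \<bullet> \<phi> = 0" if "\<phi> \<in> V k" for \<phi>
      using eq2[OF that] dd[OF that]
      by (simp add: lap inner_diff_left inner_add_left inner_commute[of _ \<phi>] inner_diff_right inner_add_right
            inner_commute[of "d k u"])
  qed
  then show ?thesis by simp
qed

end

subsection \<open>Approximating complexes\<close>

context complex_approximation
begin

lemma Wh_eq_Vh: "Wh h j = Vh h j"
  by (rule findim_hilbert_complex.W_eq_V[OF discrete_complex])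

lemma projectable_Vh: "projectable (Vh h j)"
  by (rule findim_hilbert_complex.projectable_V[OF discrete_complex])

lemma ih_star_eq_adj: "ih_star Wh Vh ih h j = adj (Vh h j) (Vh h j) (ih h j)"
  by (simp add: ih_star_def Wh_eq_Vh)

lemma ih_star_in: "ih_star Wh Vh ih h j y \<in> Vh h j"
  and ih_star_inner: "v \<in> Vh h j \<Longrightarrow> ih h j v \<bullet> y = v \<bullet> ih_star Wh Vh ih h j y"
  and bounded_linear_ih_star: "bounded_linear (ih_star Wh Vh ih h j)"
  and ih_star_norm_le: "0 \<le> M \<Longrightarrow> (\<And>v. v \<in> Vh h j \<Longrightarrow> norm (ih h j v) \<le> M * norm v)
    \<Longrightarrow> norm (ih_star Wh Vh ih h j y) \<le> M * norm y"
proof -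
  obtain C where C: "orth_basis (Vh h j) C"
    using findim_hilbert_complex.orth_basis_V[OF discrete_complex] by blast
  note A = adj_findim_in[OF C ih_linear] adj_findim_inner[OF C ih_linear]
    bounded_linear_adj_findim[OF C ih_linear] adj_findim_norm_le[OF C ih_linear]
  show "ih_star Wh Vh ih h j y \<in> Vh h j"
    "v \<in> Vh h j \<Longrightarrow> ih h j v \<bullet> y = v \<bullet> ih_star Wh Vh ih h j y"
    "bounded_linear (ih_star Wh Vh ih h j)"
    "0 \<le> M \<Longrightarrow> (\<And>v. v \<in> Vh h j \<Longrightarrow> norm (ih h j v) \<le> M * norm v)
      \<Longrightarrow> norm (ih_star Wh Vh ih h j y) \<le> M * norm y"
    unfolding ih_star_eq_adj using A by blast+
qed

text \<open>Dual to the commutation of \<open>ih\<close> with the differentials. The hypothesis says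
  only weakly that \<sigma> is the adjoint image of u, because it will be applied to time
  derivatives, for which differentiation yields exactly this form.\<close>

lemma dstar_ih_star:
  assumes "\<And>\<omega>. \<omega> \<in> V (k - 1) \<Longrightarrow> \<sigma> \<bullet> \<omega> = u \<bullet> d (k - 1) \<omega>"
  shows "dstar (Wh h) (Vh h) (dh h) k (ih_star Wh Vh ih h k u) = ih_star Wh Vh ih h (k - 1) \<sigma>"
proof (rule findim_hilbert_complex.dstar_eqI[OF discrete_complex ih_star_in])
  fix v assume v: "v \<in> Vh h (k - 1)"
  have dv: "dh h (k - 1) v \<in> Vh h k"
    using findim_hilbert_complex.d_pred_in[OF discrete_complex v] .
  have "dh h (k - 1) v \<bullet> ih_star Wh Vh ih h k u = d (k - 1) (ih h (k - 1) v) \<bullet> u"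
    using ih_star_inner[OF dv] ih_d[OF v] by simp
  also have "\<dots> = ih h (k - 1) v \<bullet> \<sigma>"
    using assms[OF linear_betweenD(1)[OF ih_linear v]] by (simp add: inner_commute)
  finally show "dh h (k - 1) v \<bullet> ih_star Wh Vh ih h k u = v \<bullet> ih_star Wh Vh ih h (k - 1) \<sigma>"
    using ih_star_inner[OF v] by simp
qed

text \<open>The interpolation operators bound discrete elements by their embeddings,
  \<open>\<parallel>x\<parallel>\<^sub>h = \<parallel>\<Pi>\<^sub>h i\<^sub>h x\<parallel>\<^sub>h \<le> M \<parallel>i\<^sub>h x\<parallel>\<close>.\<close>

lemma norm_diff_ih_star_le:
  assumes M: "0 \<le> M" "\<And>v. v \<in> Vh h j \<Longrightarrow> norm (ih h j v) \<le> M * norm v"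
      "\<And>w. w \<in> W j \<Longrightarrow> norm (interp h j w) \<le> M * norm w"
    and x: "x \<in> Vh h j"
  defines "J \<equiv> onorm_on (Wh h j) (\<lambda>x. x - ih_star Wh Vh ih h j (ih h j x))"
  shows "0 \<le> J"
    and "norm (x - ih_star Wh Vh ih h j y) \<le> M * (2 + M\<^sup>2) * (norm (ih h j x - y) + J * norm y)"
proof -
  let ?s = "ih_star Wh Vh ih h j"
  let ?A = "\<lambda>x. x - ?s (ih h j x)"
  interpret s: bounded_linear ?s by (rule bounded_linear_ih_star)
  note s_le = ih_star_norm_le[OF M(1,2)]
  have sub: "subspace (Vh h j)" using projectable_Vh by (simp add: projectable_def)
  have A_le: "norm (?A z) / norm z \<le> 1 + M\<^sup>2" if "z \<in> Vh h j" for z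
  proof -
    have "norm (?A z) \<le> norm z + norm (?s (ih h j z))" by (rule norm_triangle_ineq4)
    also have "norm (?s (ih h j z)) \<le> M * (M * norm z)"
      using s_le[of "ih h j z"] mult_left_mono[OF M(2)[OF that] M(1)] by simp
    finally have "norm (?A z) \<le> (1 + M\<^sup>2) * norm z" by (simp add: power2_eq_square algebra_simps)
    then show ?thesis by (cases "z = 0") (auto simp: divide_le_eq)
  qed
  have J: "J = (SUP z\<in>Vh h j. norm (?A z) / norm z)"
    by (simp only: J_def onorm_on_def Wh_eq_Vh[of h j])
  have bdd: "bdd_above ((\<lambda>z. norm (?A z) / norm z) ` Vh h j)"
    using A_le by (intro bdd_aboveI) auto
  have J_upper: "norm (?A z) / norm z \<le> J" if "z \<in> Vh h j" for z
    unfolding J using that bdd by (intro cSUP_upper) auto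
  \<comment> \<open>The quotient at 0 is 0 by division by zero, and it is one of the values under
    the supremum.\<close>
  show "0 \<le> J" using J_upper[OF subspace_0[OF sub]] by simp
  have J_le: "J \<le> 1 + M\<^sup>2"
    unfolding J using A_le subspace_0[OF sub] by (intro cSUP_least) auto
  have A_J: "norm (?A x) \<le> J * norm x"
  proof (cases "x = 0")
    case True
    then have "ih h j x = 0" using linear_betweenD(3)[OF ih_linear x, of 0] by simp
    then show ?thesis using True by (simp add: s.zero)
  qed (use J_upper[OF x] in \<open>simp add: divide_le_eq\<close>)
  let ?e = "norm (ih h j x - y)"
  have ix: "ih h j x \<in> W j"
    using linear_betweenD(1)[OF ih_linear x] V_subset_W by blast
  have "norm x \<le> M * norm (ih h j x)" using M(3)[OF ix] interp_ih[OF x] by simp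
  also have "norm (ih h j x) \<le> ?e + norm y" using norm_triangle_sub[of "ih h j x" y] by simp
  finally have x_le: "norm x \<le> M * (?e + norm y)" using M(1) by (simp add: mult_left_mono)
  have "norm (x - ?s y) = norm (?A x + ?s (ih h j x - y))" by (simp add: s.diff)
  also have "\<dots> \<le> norm (?A x) + norm (?s (ih h j x - y))" by (rule norm_triangle_ineq)
  also have "\<dots> \<le> J * (M * (?e + norm y)) + M * ?e"
    using A_J mult_left_mono[OF x_le \<open>0 \<le> J\<close>] s_le[of "ih h j x - y"] by simp
  also have "\<dots> = M * (J * ?e) + M * (J * norm y) + M * ?e" by (simp add: algebra_simps)
  \<comment> \<open>\<open>J\<close> is replaced by its bound \<open>1 + M\<^sup>2\<close> only in
    front of the error \<open>?e\<close>; in front of \<open>norm y\<close> it has to survive. The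
    common coefficient \<open>M * (2 + M\<^sup>2)\<close> is exact for the former and an enlargement
    for the latter.\<close>
  also have "\<dots> \<le> M * ((1 + M\<^sup>2) * ?e) + M * ((2 + M\<^sup>2) * (J * norm y)) + M * ?e"
  proof (intro add_mono mult_left_mono mult_right_mono M(1) J_le order_refl)
    have "1 * (J * norm y) \<le> (2 + M\<^sup>2) * (J * norm y)"
      using \<open>0 \<le> J\<close> by (intro mult_right_mono) auto
    then show "J * norm y \<le> (2 + M\<^sup>2) * (J * norm y)" by simp
  qed simp
  also have "\<dots> = M * (2 + M\<^sup>2) * (?e + J * norm y)" by (simp add: algebra_simps)
  finally show "norm (x - ?s y) \<le> M * (2 + M\<^sup>2) * (?e + J * norm y)" .
qed

lemma tderiv_diff_ih_star:
  assumes "0 < T" "tdifferentiable T v" "tdifferentiable T w" "t \<in> {0..T}"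
  shows "((\<lambda>t. v t - ih_star Wh Vh ih h j (w t)) has_vector_derivative
      tderiv T v t - ih_star Wh Vh ih h j (tderiv T w t)) (at t within {0..T})"
    and "tderiv T (\<lambda>t. v t - ih_star Wh Vh ih h j (w t)) t
      = tderiv T v t - ih_star Wh Vh ih h j (tderiv T w t)"
proof -
  show *: "((\<lambda>t. v t - ih_star Wh Vh ih h j (w t)) has_vector_derivative
      tderiv T v t - ih_star Wh Vh ih h j (tderiv T w t)) (at t within {0..T})"
    by (intro has_vector_derivative_diff tderiv_works assms
        bounded_linear.has_vector_derivative[OF bounded_linear_ih_star])
  show "tderiv T (\<lambda>t. v t - ih_star Wh Vh ih h j (w t)) t
      = tderiv T v t - ih_star Wh Vh ih h j (tderiv T w t)"
    by (rule tderiv_eqI[OF assms(1,4) *])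
qed

lemma ih_bounded_at: "\<exists>M. \<forall>v\<in>Vh h j. norm (ih h j v) \<le> M * norm v"
  using ih_bounded by blast

lemma interp_bounded_at: "\<exists>M. \<forall>w\<in>W j. norm (interp h j w) \<le> M * norm w"
  using interp_bounded by blast

lemma L2_norm_tderiv_diff_ih_star_le:
  assumes M: "0 \<le> M" "\<And>v. v \<in> Vh h j \<Longrightarrow> norm (ih h j v) \<le> M * norm v"
      "\<And>w. w \<in> W j \<Longrightarrow> norm (interp h j w) \<le> M * norm w"
    and T: "0 < T" and v: "tdifferentiable T v" and w: "tdifferentiable T w"
    and v_in: "\<And>t. t \<in> {0..T} \<Longrightarrow> v t \<in> Vh h j"
  shows "L2_norm T (tderiv T (\<lambda>t. v t - ih_star Wh Vh ih h j (w t)))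
    \<le> ennreal (2 * (M * (2 + M\<^sup>2))) * (L2_norm T (\<lambda>t. ih h j (tderiv T v t) - tderiv T w t)
      + ennreal (onorm_on (Wh h j) (\<lambda>x. x - ih_star Wh Vh ih h j (ih h j x))) * L2_norm T (tderiv T w))"
proof (rule L2_norm_add_le)
  have v'_in: "tderiv T v t \<in> Vh h j" if "t \<in> {0..T}" for t
    by (rule projectable_has_vector_derivative_in[OF projectable_Vh T v_in that tderiv_works[OF v that]])
  show "norm (tderiv T (\<lambda>t. v t - ih_star Wh Vh ih h j (w t)) t)
      \<le> M * (2 + M\<^sup>2) * (norm (ih h j (tderiv T v t) - tderiv T w t)
        + onorm_on (Wh h j) (\<lambda>x. x - ih_star Wh Vh ih h j (ih h j x)) * norm (tderiv T w t))"
    if t: "t \<in> {0..T}" for t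
    unfolding tderiv_diff_ih_star(2)[OF T v w t]
    by (rule norm_diff_ih_star_le(2)[OF M v'_in[OF t]])
  show "0 \<le> M * (2 + M\<^sup>2)" using M(1) by simp
  show "0 \<le> onorm_on (Wh h j) (\<lambda>x. x - ih_star Wh Vh ih h j (ih h j x))"
    using norm_diff_ih_star_le(1)[OF M, of "v 0"] v_in T by simp
  show "set_borel_measurable borel {0..T} (\<lambda>t. norm (tderiv T w t))"
    using w T by (rule set_borel_measurable_norm_tderiv)
  \<comment> \<open>The integrand is itself the time derivative of a curve, and this provides its
    measurability.\<close>
  have deriv: "((\<lambda>t. ih h j (v t) - w t) has_vector_derivative ih h j (tderiv T v t) - tderiv T w t)
      (at t within {0..T})" if t: "t \<in> {0..T}" for t
    by (intro has_vector_derivative_diff tderiv_works[OF w t]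
        has_vector_derivative_linear_between[OF projectable_Vh T v_in t tderiv_works[OF v t] ih_linear
          ih_bounded_at])
  have "set_borel_measurable borel {0..T} (\<lambda>t. norm (tderiv T (\<lambda>t. ih h j (v t) - w t) t))"
    using tdifferentiableI[OF deriv] T by (rule set_borel_measurable_norm_tderiv)
  then show "set_borel_measurable borel {0..T} (\<lambda>t. norm (ih h j (tderiv T v t) - tderiv T w t))"
    by (rule set_borel_measurable_congI) (use tderiv_eqI[OF T _ deriv] in simp)
qed

section \<open>The error equation of one discretization and its estimates\<close>

context
  fixes k :: int and T :: real and f :: "real \<Rightarrow> 'w" and g and \<sigma> u :: "real \<Rightarrow> 'w" and h :: 'h
    and \<sigma>h uh \<sigma>' u' p' :: "real \<Rightarrow> 'v"
  assumes T: "0 < T"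
    and parabolic: "parabolic_solution W V d k T f g \<sigma> u"
    and regular: "sufficiently_regular W V d k T f \<sigma> u"
    and elliptic: "elliptic_projection W V d (Vh h) (dh h) (interp h) k T u \<sigma>' u' p'"
    and semidiscrete: "semidiscrete_solution (Vh h) (dh h) (interp h) k T f (u' 0) \<sigma>h uh"
begin

abbreviation (input) "istar \<equiv> ih_star Wh Vh ih h"
abbreviation (input) "dstar\<^sub>h \<equiv> dstar (Wh h) (Vh h) (dh h)"
abbreviation (input) "\<delta> \<equiv> \<lambda>t. interp h k (tderiv T u t) - istar k (tderiv T u t)"

interpretation discrete: findim_hilbert_complex "Wh h" "Vh h" "dh h"
  by (rule discrete_complex)

lemma u_diff: "tdifferentiable T u" and \<sigma>_diff: "tdifferentiable T \<sigma>"
  and laplacian_u_diff: "tdifferentiable T (\<lambda>t. laplacian W V d k (u t))"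
  and uh_diff: "tdifferentiable T uh"
  using regular semidiscrete by (simp_all add: sufficiently_regular_def semidiscrete_solution_def)

lemma u_in: "t \<in> {0..T} \<Longrightarrow> u t \<in> laplacian_dom W V d k"
  and f_in: "t \<in> {0..T} \<Longrightarrow> f t \<in> W k"
  and u_V: "t \<in> {0..T} \<Longrightarrow> u t \<in> V k" and \<sigma>_V: "t \<in> {0..T} \<Longrightarrow> \<sigma> t \<in> V (k - 1)"
  using regular parabolic by (simp_all add: sufficiently_regular_def parabolic_solution_def)

lemma u_W: "t \<in> {0..T} \<Longrightarrow> u t \<in> W k"
  using u_V V_subset_W by blast

lemma tderiv_u_W: "t \<in> {0..T} \<Longrightarrow> tderiv T u t \<in> W k"
  using regular by (intro subsetD[OF V_subset_W]) (simp add: sufficiently_regular_def laplacian_dom_def)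

lemma \<sigma>_weak: "t \<in> {0..T} \<Longrightarrow> \<omega> \<in> V (k - 1) \<Longrightarrow> \<sigma> t \<bullet> \<omega> = u t \<bullet> d (k - 1) \<omega>"
  using parabolic by (simp add: parabolic_solution_def)

text \<open>With \<open>\<omega>\<close> fixed, both sides are bounded functionals of the curves, so
  the time derivative never has to pass through the unbounded \<open>d\<close>.\<close>

lemma tderiv_\<sigma>_weak:
  assumes t: "t \<in> {0..T}" and \<omega>: "\<omega> \<in> V (k - 1)"
  shows "tderiv T \<sigma> t \<bullet> \<omega> = tderiv T u t \<bullet> d (k - 1) \<omega>"
proof -
  have "((\<lambda>t. u t \<bullet> d (k - 1) \<omega>) has_vector_derivative tderiv T u t \<bullet> d (k - 1) \<omega>) (at t within {0..T})"
    by (rule bounded_linear.has_vector_derivative[OF bounded_linear_inner_left tderiv_works[OF u_diff t]])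
  then have "((\<lambda>t. \<sigma> t \<bullet> \<omega>) has_vector_derivative tderiv T u t \<bullet> d (k - 1) \<omega>) (at t within {0..T})"
    by (rule has_vector_derivative_transform[OF t, rotated]) (simp add: \<sigma>_weak \<omega>)
  moreover have "((\<lambda>t. \<sigma> t \<bullet> \<omega>) has_vector_derivative tderiv T \<sigma> t \<bullet> \<omega>) (at t within {0..T})"
    by (rule bounded_linear.has_vector_derivative[OF bounded_linear_inner_left tderiv_works[OF \<sigma>_diff t]])
  ultimately show ?thesis using tderiv_eqI[OF T t] by metis
qed

lemma f_eq: "t \<in> {0..T} \<Longrightarrow> f t = tderiv T u t + - laplacian W V d k (u t)"
  using parabolic
  by (intro weak_solution_imp_strong u_in tderiv_u_W f_in \<sigma>_V \<sigma>_weak) (auto simp: parabolic_solution_def)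

lemma neg_laplacian_W: "t \<in> {0..T} \<Longrightarrow> - laplacian W V d k (u t) \<in> W k"
  by (intro subspace_neg subspace_W laplacian_in_W u_in)

lemma interp_has_vector_derivative:
  assumes "\<And>s. s \<in> {0..T} \<Longrightarrow> w s \<in> W k" "t \<in> {0..T}" "(w has_vector_derivative w') (at t within {0..T})"
  shows "((\<lambda>s. interp h k (w s)) has_vector_derivative interp h k w') (at t within {0..T})"
  using has_vector_derivative_linear_between[OF projectable_W T assms interp_linear interp_bounded_at] .

text \<open>Both data of the elliptic projection are images of differentiable curves under
  \<open>interp\<close>; for the harmonic constraint the curve is the harmonic projection of
  u.\<close>

lemma p'_diff: "tdifferentiable T p'" and u'_diff: "tdifferentiable T u'" and \<sigma>'_diff: "tdifferentiable T \<sigma>'"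
proof -
  have r: "tdifferentiable T (\<lambda>t. interp h k (- laplacian W V d k (u t)))"
    by (rule tdifferentiableI, rule interp_has_vector_derivative[OF neg_laplacian_W],
        assumption+, rule has_vector_derivative_minus, rule tderiv_works[OF laplacian_u_diff])
  have z: "tdifferentiable T (\<lambda>t. interp h k (orth_proj (harmonics V d k) (u t)))"
    by (rule tdifferentiableI,
        rule interp_has_vector_derivative[OF subsetD[OF harmonics_subset_W orth_proj_in[OF projectable_harmonics]]],
        assumption,
        rule bounded_linear.has_vector_derivative[OF bounded_linear_orth_proj[OF projectable_harmonics]],
        rule tderiv_works[OF u_diff])
  show "tdifferentiable T p'" "tdifferentiable T u'" "tdifferentiable T \<sigma>'"
    using elliptic
    by (auto simp: elliptic_projection_def intro!: discrete.elliptic_tdifferentiable[OF r z, of \<sigma>' k u' p'])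
qed

lemma u'_in: "t \<in> {0..T} \<Longrightarrow> u' t \<in> Vh h k" and \<sigma>'_in: "t \<in> {0..T} \<Longrightarrow> \<sigma>' t \<in> Vh h (k - 1)"
  and p'_in: "t \<in> {0..T} \<Longrightarrow> p' t \<in> harmonics (Vh h) (dh h) k"
  and uh_in: "t \<in> {0..T} \<Longrightarrow> uh t \<in> Vh h k" and \<sigma>h_in: "t \<in> {0..T} \<Longrightarrow> \<sigma>h t \<in> Vh h (k - 1)"
  using elliptic semidiscrete by (simp_all add: elliptic_projection_def semidiscrete_solution_def)

lemma \<sigma>'_weak: "t \<in> {0..T} \<Longrightarrow> \<omega> \<in> Vh h (k - 1) \<Longrightarrow> \<sigma>' t \<bullet> \<omega> = u' t \<bullet> dh h (k - 1) \<omega>"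
  and \<sigma>h_weak: "t \<in> {0..T} \<Longrightarrow> \<omega> \<in> Vh h (k - 1) \<Longrightarrow> \<sigma>h t \<bullet> \<omega> = uh t \<bullet> dh h (k - 1) \<omega>"
  using elliptic semidiscrete by (simp_all add: elliptic_projection_def semidiscrete_solution_def)

lemma tderiv_\<theta>:
  assumes t: "t \<in> {0..T}"
  shows "tderiv T (\<lambda>t. uh t - u' t) t = tderiv T uh t - tderiv T u' t"
  by (intro tderiv_eqI[OF T t] has_vector_derivative_diff tderiv_works uh_diff u'_diff t)

lemma \<theta>_diff: "tdifferentiable T (\<lambda>t. uh t - u' t)"
  using uh_diff u'_diff by (simp add: tdifferentiable_def)

lemma \<rho>_diff: "tdifferentiable T (\<lambda>t. u' t - istar k (u t))"
  and \<psi>_diff: "tdifferentiable T (\<lambda>t. \<sigma>' t - istar (k - 1) (\<sigma> t))"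
  by (intro tdifferentiableI[OF tderiv_diff_ih_star(1)] T u'_diff u_diff \<sigma>'_diff \<sigma>_diff; assumption)+

text \<open>Inserting and removing \<open>istar k (tderiv T u t)\<close> splits
  \<open>interp h k (tderiv T u t) - tderiv T u' t\<close> into -\<rho>_t and \<delta>. The sign of
  \<open>p'\<close> is positive because it stands on the left of the elliptic problem, which is
  subtracted.\<close>

definition "residual t = - tderiv T (\<lambda>t. u' t - istar k (u t)) t + p' t + \<delta> t"

lemma error_equation:
  assumes t: "t \<in> {0..T}" and \<phi>: "\<phi> \<in> Vh h k"
  shows "tderiv T (\<lambda>t. uh t - u' t) t \<bullet> \<phi> + dh h (k - 1) (\<sigma>h t - \<sigma>' t) \<bullet> \<phi>
    + dh h k (uh t - u' t) \<bullet> dh h k \<phi> = residual t \<bullet> \<phi>"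
proof -
  have "interp h k (f t) = interp h k (tderiv T u t) + interp h k (- laplacian W V d k (u t))"
    unfolding f_eq[OF t] by (rule linear_betweenD(2)[OF interp_linear tderiv_u_W[OF t] neg_laplacian_W[OF t]])
  moreover have "tderiv T uh t \<bullet> \<phi> + dh h (k - 1) (\<sigma>h t) \<bullet> \<phi> + dh h k (uh t) \<bullet> dh h k \<phi> = interp h k (f t) \<bullet> \<phi>"
    using semidiscrete t \<phi> by (simp add: semidiscrete_solution_def)
  moreover have "dh h (k - 1) (\<sigma>' t) \<bullet> \<phi> + dh h k (u' t) \<bullet> dh h k \<phi> + p' t \<bullet> \<phi>
      = interp h k (- laplacian W V d k (u t)) \<bullet> \<phi>"
    using elliptic t \<phi> by (simp add: elliptic_projection_def)
  moreover have "dh h (k - 1) (\<sigma>h t - \<sigma>' t) = dh h (k - 1) (\<sigma>h t) - dh h (k - 1) (\<sigma>' t)"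
    by (rule linear_between_diff[OF discrete.d_linear discrete.subspace_V \<sigma>h_in[OF t] \<sigma>'_in[OF t]])
  moreover have "dh h k (uh t - u' t) = dh h k (uh t) - dh h k (u' t)"
    by (rule linear_between_diff[OF discrete.d_linear discrete.subspace_V uh_in[OF t] u'_in[OF t]])
  ultimately show ?thesis
    unfolding residual_def tderiv_\<theta>[OF t] tderiv_diff_ih_star(2)[OF T u'_diff u_diff t]
    by (simp add: inner_diff_left inner_add_left)
qed

lemma dstar_residual:
  assumes t: "t \<in> {0..T}"
  shows "dstar\<^sub>h k (residual t) = - tderiv T (\<lambda>t. \<sigma>' t - istar (k - 1) (\<sigma> t)) t + dstar\<^sub>h k (\<delta> t)"
proof -
  interpret ds: bounded_linear "dstar\<^sub>h k" by (rule discrete.bounded_linear_dstar)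
  have \<sigma>'_eq: "\<sigma>' s = dstar\<^sub>h k (u' s)" if "s \<in> {0..T}" for s
    using \<sigma>'_weak[OF that] \<sigma>'_in[OF that] by (intro discrete.dstar_eqI[symmetric]) (auto simp: inner_commute)
  have "(\<sigma>' has_vector_derivative dstar\<^sub>h k (tderiv T u' t)) (at t within {0..T})"
    using ds.has_vector_derivative[OF tderiv_works[OF u'_diff t]]
    by (rule has_vector_derivative_transform[OF t, rotated]) (rule \<sigma>'_eq)
  then have "tderiv T \<sigma>' t = dstar\<^sub>h k (tderiv T u' t)" by (rule tderiv_eqI[OF T t])
  moreover have "dstar\<^sub>h k (istar k (tderiv T u t)) = istar (k - 1) (tderiv T \<sigma> t)"
    using tderiv_\<sigma>_weak[OF t] by (rule dstar_ih_star)
  ultimately show ?thesis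
    unfolding residual_def tderiv_diff_ih_star(2)[OF T u'_diff u_diff t]
      tderiv_diff_ih_star(2)[OF T \<sigma>'_diff \<sigma>_diff t]
    by (simp add: ds.add ds.diff ds.neg discrete.dstar_harmonic[OF p'_in[OF t]])
qed

text \<open>Exhibits \<delta> as a time derivative, whence the measurability of its norm without
  continuity of u_t.\<close>

lemma \<delta>_deriv:
  assumes t: "t \<in> {0..T}"
  shows "((\<lambda>t. interp h k (u t) - istar k (u t)) has_vector_derivative \<delta> t) (at t within {0..T})"
  by (intro has_vector_derivative_diff interp_has_vector_derivative u_W t tderiv_works u_diff
      bounded_linear.has_vector_derivative[OF bounded_linear_ih_star])

lemma \<delta>_measurable: "set_borel_measurable borel {0..T} (\<lambda>t. norm (\<delta> t))"
  by (rule set_borel_measurable_congI[OF set_borel_measurable_norm_tderiv[OF tdifferentiableI[OF \<delta>_deriv] T]])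
     (use tderiv_eqI[OF T _ \<delta>_deriv] in simp_all)

lemma dstar_\<delta>_measurable: "set_borel_measurable borel {0..T} (\<lambda>t. norm (dstar\<^sub>h k (\<delta> t)))"
proof -
  note deriv = bounded_linear.has_vector_derivative[OF discrete.bounded_linear_dstar[of k] \<delta>_deriv]
  show ?thesis
    by (rule set_borel_measurable_congI[OF set_borel_measurable_norm_tderiv[OF tdifferentiableI[OF deriv] T]])
       (use tderiv_eqI[OF T _ deriv] in simp_all)
qed

lemma p'_measurable: "set_borel_measurable borel {0..T} (\<lambda>t. norm (p' t))"
  by (intro set_borel_measurable_norm_continuous tdifferentiable_continuous_on p'_diff)

lemma \<rho>_measurable: "set_borel_measurable borel {0..T} (\<lambda>t. norm (tderiv T (\<lambda>t. u' t - istar k (u t)) t))"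
  by (intro set_borel_measurable_norm_tderiv \<rho>_diff T)

lemma \<psi>_measurable:
  "set_borel_measurable borel {0..T} (\<lambda>t. norm (tderiv T (\<lambda>t. \<sigma>' t - istar (k - 1) (\<sigma> t)) t))"
  by (intro set_borel_measurable_norm_tderiv \<psi>_diff T)

lemma \<theta>_in: "t \<in> {0..T} \<Longrightarrow> uh t - u' t \<in> Vh h k"
  and \<epsilon>_in: "t \<in> {0..T} \<Longrightarrow> \<sigma>h t - \<sigma>' t \<in> Vh h (k - 1)"
  by (simp_all add: subspace_diff discrete.subspace_V uh_in u'_in \<sigma>h_in \<sigma>'_in)

lemma \<epsilon>_weak: "t \<in> {0..T} \<Longrightarrow> \<omega> \<in> Vh h (k - 1) \<Longrightarrow>
    (\<sigma>h t - \<sigma>' t) \<bullet> \<omega> = (uh t - u' t) \<bullet> dh h (k - 1) \<omega>"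
  by (simp add: inner_diff_left \<sigma>'_weak \<sigma>h_weak)

lemma \<theta>_zero: "uh 0 - u' 0 = 0"
  using semidiscrete by (simp add: semidiscrete_solution_def)

lemma residual_le:
  "norm (residual t) \<le> norm (tderiv T (\<lambda>t. u' t - istar k (u t)) t) + norm (p' t) + norm (\<delta> t)"
proof -
  have "norm (- a + b + c) \<le> norm a + norm b + norm c" for a b c :: 'v
    using norm_triangle_ineq[of "- a + b" c] norm_triangle_ineq[of "- a" b] by simp
  then show ?thesis unfolding residual_def .
qed

lemmas bound_measurable = set_borel_measurable_add[OF set_borel_measurable_add[OF \<rho>_measurable p'_measurable] \<delta>_measurable]

lemma \<theta>_estimate:
  assumes t: "t \<in> {0..T}"
  shows "ennreal (norm (uh t - u' t))
    \<le> L1_norm T (tderiv T (\<lambda>t. u' t - istar k (u t))) + L1_norm T p' + L1_norm T \<delta>"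
proof -
  have "ennreal (norm (uh t - u' t)) \<le>
      L1_norm T (\<lambda>t. norm (tderiv T (\<lambda>t. u' t - istar k (u t)) t) + norm (p' t) + norm (\<delta> t))"
    by (rule discrete.energy_theta[OF T \<theta>_diff \<theta>_zero \<theta>_in \<epsilon>_in \<epsilon>_weak error_equation
        bound_measurable residual_le t])
  also have "\<dots> \<le> L1_norm T (tderiv T (\<lambda>t. u' t - istar k (u t))) + L1_norm T p' + L1_norm T \<delta>"
    by (rule L1_norm_add3_le[OF _ \<rho>_measurable p'_measurable \<delta>_measurable]) simp
  finally show ?thesis .
qed

lemma d_\<theta>_\<epsilon>_estimate:
  assumes t: "t \<in> {0..T}"
  shows "ennreal (norm (dh h k (uh t - u' t)) + norm (\<sigma>h t - \<sigma>' t))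
    \<le> 8 * (L2_norm T (tderiv T (\<lambda>t. u' t - istar k (u t))) + L2_norm T p' + L2_norm T \<delta>)"
proof -
  have "ennreal (norm (dh h k (uh t - u' t)) + norm (\<sigma>h t - \<sigma>' t)) \<le>
      2 * L2_norm T (\<lambda>t. norm (tderiv T (\<lambda>t. u' t - istar k (u t)) t) + norm (p' t) + norm (\<delta> t))"
    by (rule discrete.energy_d_theta_epsilon[OF T \<theta>_diff \<theta>_zero \<theta>_in \<epsilon>_in \<epsilon>_weak error_equation
        bound_measurable residual_le t])
  also have "\<dots> \<le> 2 * (4 * (L2_norm T (tderiv T (\<lambda>t. u' t - istar k (u t))) + L2_norm T p' + L2_norm T \<delta>))"
    by (intro mult_left_mono L2_norm_add3_le \<rho>_measurable p'_measurable \<delta>_measurable) simp_all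
  finally show ?thesis by (simp add: mult.assoc[symmetric])
qed

lemma d_\<epsilon>_estimate:
  assumes t: "t \<in> {0..T}"
  shows "ennreal (norm (dh h (k - 1) (\<sigma>h t - \<sigma>' t)))
    \<le> 2 * (L2_norm T (tderiv T (\<lambda>t. \<sigma>' t - istar (k - 1) (\<sigma> t))) + L2_norm T (\<lambda>t. dstar\<^sub>h k (\<delta> t)))"
proof -
  have le: "norm (dstar\<^sub>h k (residual s)) \<le>
      norm (tderiv T (\<lambda>t. \<sigma>' t - istar (k - 1) (\<sigma> t)) s) + norm (dstar\<^sub>h k (\<delta> s))" if "s \<in> {0..T}" for s
    unfolding dstar_residual[OF that] by (rule order_trans[OF norm_triangle_ineq]) simp
  have "ennreal (norm (dh h (k - 1) (\<sigma>h t - \<sigma>' t))) \<le>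
      L2_norm T (\<lambda>s. norm (tderiv T (\<lambda>t. \<sigma>' t - istar (k - 1) (\<sigma> t)) s) + norm (dstar\<^sub>h k (\<delta> s)))"
    by (rule discrete.energy_d_epsilon[OF T \<theta>_diff \<theta>_zero \<theta>_in \<epsilon>_in \<epsilon>_weak error_equation
        set_borel_measurable_add[OF \<psi>_measurable dstar_\<delta>_measurable] le t])
  also have "\<dots> \<le> 2 * (L2_norm T (tderiv T (\<lambda>t. \<sigma>' t - istar (k - 1) (\<sigma> t))) + L2_norm T (\<lambda>t. dstar\<^sub>h k (\<delta> t)))"
    by (intro L2_norm_add2_le \<psi>_measurable dstar_\<delta>_measurable) simp
  finally show ?thesis .
qed

end

section \<open>Constants independent of h, and the theorem\<close>

lemma uniform_bound:
  "\<exists>M\<ge>0. \<forall>h. (\<forall>v\<in>Vh h j. norm (ih h j v) \<le> M * norm v) \<and> (\<forall>w\<in>W j. norm (interp h j w) \<le> M * norm w)"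
proof -
  obtain M1 M2 where M: "\<And>h v. v \<in> Vh h j \<Longrightarrow> norm (ih h j v) \<le> M1 * norm v"
    "\<And>h w. w \<in> W j \<Longrightarrow> norm (interp h j w) \<le> M2 * norm w"
    using ih_bounded interp_bounded by meson
  \<comment> \<open>The assumed bounds may be negative when the spaces are trivial; the maximum with
    0 makes one nonnegative constant serve both maps.\<close>
  have max1: "M1 * norm v \<le> max 0 (max M1 M2) * norm v" for v :: 'v by (intro mult_right_mono) auto
  have max2: "M2 * norm w \<le> max 0 (max M1 M2) * norm w" for w :: 'w by (intro mult_right_mono) auto
  show ?thesis
    using order_trans[OF M(1) max1] order_trans[OF M(2) max2]
    by (intro exI[of _ "max 0 (max M1 M2)"]) simp
qed

end

theorem theorem4p2:
  fixes W V :: "int \<Rightarrow> 'w::real_inner set" and d :: "int \<Rightarrow> 'w \<Rightarrow> 'w"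
    and Wh Vh :: "'h \<Rightarrow> int \<Rightarrow> 'v::real_inner set" and dh :: "'h \<Rightarrow> int \<Rightarrow> 'v \<Rightarrow> 'v"
    and ih :: "'h \<Rightarrow> int \<Rightarrow> 'v \<Rightarrow> 'w" and pih interp :: "'h \<Rightarrow> int \<Rightarrow> 'w \<Rightarrow> 'v"
    and k :: int and T :: real
  assumes "complex_approximation W V d Wh Vh dh ih pih interp"
    and "0 < T"
  shows "\<exists>C\<ge>0. \<forall>f g \<sigma> u h \<sigma>h uh \<sigma>' u' p'.
    parabolic_solution W V d k T f g \<sigma> u \<longrightarrow>
    sufficiently_regular W V d k T f \<sigma> u \<longrightarrow>
    elliptic_projection W V d (Vh h) (dh h) (interp h) k T u \<sigma>' u' p' \<longrightarrow>
    semidiscrete_solution (Vh h) (dh h) (interp h) k T f (u' 0) \<sigma>h uh \<longrightarrow>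
    (let istar = ih_star Wh Vh ih h;
         \<rho> = (\<lambda>t. u' t - istar k (u t));
         \<theta> = (\<lambda>t. uh t - u' t);
         \<psi> = (\<lambda>t. \<sigma>' t - istar (k - 1) (\<sigma> t));
         \<epsilon> = (\<lambda>t. \<sigma>h t - \<sigma>' t);
         u_t = tderiv T u;
         \<sigma>_t = tderiv T \<sigma>;
         \<rho>_t = tderiv T \<rho>;
         \<psi>_t = tderiv T \<psi>;
         \<delta> = (\<lambda>t. interp h k (u_t t) - istar k (u_t t));
         J_err = (\<lambda>j. onorm_on (Wh h j) (\<lambda>x. x - istar j (ih h j x)))
     in (\<forall>t\<in>{0..T}.
           ennreal (norm (\<theta> t)) \<le> L1_norm T \<rho>_t + L1_norm T p' + L1_norm T \<delta> \<and>
           ennreal (norm (dh h k (\<theta> t)) + norm (\<epsilon> t))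
             \<le> ennreal C * (L2_norm T \<rho>_t + L2_norm T p' + L2_norm T \<delta>) \<and>
           ennreal (norm (dh h (k - 1) (\<epsilon> t)))
             \<le> ennreal C * (L2_norm T \<psi>_t
                  + L2_norm T (\<lambda>t. dstar (Wh h) (Vh h) (dh h) k (\<delta> t)))) \<and>
        L2_norm T \<rho>_t
          \<le> ennreal C * (L2_norm T (\<lambda>t. ih h k (tderiv T u' t) - u_t t)
               + ennreal (J_err k) * L2_norm T u_t) \<and>
        L2_norm T \<psi>_t
          \<le> ennreal C * (L2_norm T (\<lambda>t. ih h (k - 1) (tderiv T \<sigma>' t) - \<sigma>_t t)
               + ennreal (J_err (k - 1)) * L2_norm T \<sigma>_t))"
proof -
  interpret complex_approximation W V d Wh Vh dh ih pih interp by fact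
  obtain M1 where M1: "0 \<le> M1" "\<And>h v. v \<in> Vh h k \<Longrightarrow> norm (ih h k v) \<le> M1 * norm v"
    "\<And>h w. w \<in> W k \<Longrightarrow> norm (interp h k w) \<le> M1 * norm w"
    using uniform_bound[of k] by blast
  obtain M2 where M2: "0 \<le> M2" "\<And>h v. v \<in> Vh h (k - 1) \<Longrightarrow> norm (ih h (k - 1) v) \<le> M2 * norm v"
    "\<And>h w. w \<in> W (k - 1) \<Longrightarrow> norm (interp h (k - 1) w) \<le> M2 * norm w"
    using uniform_bound[of "k - 1"] by blast
  define K1 K2 where K: "K1 = 2 * (M1 * (2 + M1\<^sup>2))" "K2 = 2 * (M2 * (2 + M2\<^sup>2))"
  \<comment> \<open>8 is the factor 2 of \<open>energy_d_theta_epsilon\<close> times the 4 of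
    \<open>L2_norm_add3_le\<close>, and it also covers the 2 in the bound for d\<epsilon>.
    \<open>K1\<close> and \<open>K2\<close> belong to the degrees k and k - 1 and depend only on the
    uniform bounds, so \<open>C\<close> is the same for all h and all solutions.\<close>
  define C where "C = 8 + K1 + K2"
  have K_nonneg: "0 \<le> K1" "0 \<le> K2" using M1(1) M2(1) by (simp_all add: K)
  have C: "0 \<le> C" "K1 \<le> C" "K2 \<le> C" "8 \<le> C" "2 \<le> C" using K_nonneg by (simp_all add: C_def)
  have weaken: "x \<le> ennreal C * y" if "x \<le> ennreal a * y" "a \<le> C" for x y a
    using that(1) mult_right_mono[OF ennreal_leI[OF that(2)], of y] by (rule order_trans) simp
  have weaken': "x \<le> ennreal C * y" if "x \<le> numeral n * y" "numeral n \<le> C" for x y n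
    using weaken[of x "numeral n" y] that by simp
  show ?thesis
    unfolding Let_def
  proof (intro exI[of _ C] conjI allI impI ballI C(1))
    fix f g \<sigma> u h \<sigma>h uh \<sigma>' u' p'
    assume A: "parabolic_solution W V d k T f g \<sigma> u" "sufficiently_regular W V d k T f \<sigma> u"
      "elliptic_projection W V d (Vh h) (dh h) (interp h) k T u \<sigma>' u' p'"
      "semidiscrete_solution (Vh h) (dh h) (interp h) k T f (u' 0) \<sigma>h uh"
    note A = \<open>0 < T\<close> A
    {
      fix t assume t: "t \<in> {0..T}"
      let ?\<delta> = "\<lambda>t. interp h k (tderiv T u t) - ih_star Wh Vh ih h k (tderiv T u t)"
      show "ennreal (norm (uh t - u' t))
          \<le> L1_norm T (tderiv T (\<lambda>t. u' t - ih_star Wh Vh ih h k (u t))) + L1_norm T p' + L1_norm T ?\<delta>"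
        by (rule \<theta>_estimate[OF A t])
      show "ennreal (norm (dh h k (uh t - u' t)) + norm (\<sigma>h t - \<sigma>' t))
          \<le> ennreal C * (L2_norm T (tderiv T (\<lambda>t. u' t - ih_star Wh Vh ih h k (u t)))
            + L2_norm T p' + L2_norm T ?\<delta>)"
        by (rule weaken'[OF d_\<theta>_\<epsilon>_estimate[OF A t] C(4)])
      show "ennreal (norm (dh h (k - 1) (\<sigma>h t - \<sigma>' t)))
          \<le> ennreal C * (L2_norm T (tderiv T (\<lambda>t. \<sigma>' t - ih_star Wh Vh ih h (k - 1) (\<sigma> t)))
            + L2_norm T (\<lambda>t. dstar (Wh h) (Vh h) (dh h) k (?\<delta> t)))"
        by (rule weaken'[OF d_\<epsilon>_estimate[OF A t] C(5)])
    }
    show "L2_norm T (tderiv T (\<lambda>t. u' t - ih_star Wh Vh ih h k (u t)))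
        \<le> ennreal C * (L2_norm T (\<lambda>t. ih h k (tderiv T u' t) - tderiv T u t)
          + ennreal (onorm_on (Wh h k) (\<lambda>x. x - ih_star Wh Vh ih h k (ih h k x))) * L2_norm T (tderiv T u))"
      by (rule weaken[OF L2_norm_tderiv_diff_ih_star_le[OF M1 \<open>0 < T\<close> u'_diff[OF A] u_diff[OF A] u'_in[OF A],
              folded K] C(2)])
    show "L2_norm T (tderiv T (\<lambda>t. \<sigma>' t - ih_star Wh Vh ih h (k - 1) (\<sigma> t)))
        \<le> ennreal C * (L2_norm T (\<lambda>t. ih h (k - 1) (tderiv T \<sigma>' t) - tderiv T \<sigma> t)
          + ennreal (onorm_on (Wh h (k - 1)) (\<lambda>x. x - ih_star Wh Vh ih h (k - 1) (ih h (k - 1) x)))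
            * L2_norm T (tderiv T \<sigma>))"
      by (rule weaken[OF L2_norm_tderiv_diff_ih_star_le[OF M2 \<open>0 < T\<close> \<sigma>'_diff[OF A] \<sigma>_diff[OF A] \<sigma>'_in[OF A],
              folded K] C(3)])
  qed
qed

end
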